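(* Let $N\ge 1$, $0<\theta\le 2$ and $p>1$, and set $p_\theta:=1+\theta/N$. Let $A>0$ and let $\phi$ be a nonnegative measurable function in $\mathbf{R}^N$ such that $0\le\phi(x)\le(1+|x|)^{-A}$ for almost all $x\in\mathbf{R}^N$. For $\lambda>0$ let $T(\lambda\phi)$ be the maximal existence time of the minimal solution of the Cauchy problem $\partial_t u+(-\Delta)^{\theta/2}u=u^p$, $u(0)=\lambda\phi$ (see the context). (i) Let $p=p_\theta$ and $A\ge\theta/(p-1)=N$. Then there exists a positive constant $C_1$ such that $$\log T(\lambda\phi)\ge\begin{cases}C_1\lambda^{-(p-1)}&\text{if }A>N,\\ C_1\lambda^{-\frac{p-1}{p}}&\text{if }A=N,\end{cases}$$ for all small enough $\lambda>0$. (ii) Let $1<p<p_\theta$ or $A<\theta/(p-1)$. Then there exists a positive constant $C_2$ such that $$T(\lambda\phi)\ge\begin{cases}C_2\lambda^{-\left(\frac{1}{p-1}-\frac1\theta\min\{A,N\}\right)^{-1}}&\text{if }A\ne N,\\ C_2\left(\dfrac{\lambda^{-1}}{\log(\lambda^{-1})}\right)^{\left(\frac{1}{p-1}-\frac N\theta\right)^{-1}}&\text{if }A=N,\end{cases}$$ for all small enough $\lambda>0$.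
   Context: A nonnegative locally integrable function $\mu$ is identified with the Radon measure $\mu\,dx$. $G=G(x,t)$ denotes the fundamental solution of $\partial_t u+(-\Delta)^{\theta/2}u=0$ in $\mathbf{R}^N\times(0,\infty)$, i.e. the positive smooth kernel with $\int_{\mathbf{R}^N}G(x,t)e^{-i\xi\cdot x}\,dx=e^{-t|\xi|^\theta}$ (the Gauss kernel $(4\pi t)^{-N/2}e^{-|x|^2/4t}$ when $\theta=2$). For a Radon measure $\mu$ in $\mathbf{R}^N$ and $0<T\le\infty$, a nonnegative measurable function $u$ in $\mathbf{R}^N\times(0,T)$ is a solution of the Cauchy problem $\partial_t u+(-\Delta)^{\theta/2}u=u^p$, $u(0)=\mu$, in $\mathbf{R}^N\times[0,T)$ if $$\infty>u(x,t)=\int_{\mathbf{R}^N}G(x-y,t)\,d\mu(y)+\int_0^t\int_{\mathbf{R}^N}G(x-y,t-s)u(y,s)^p\,dy\,ds$$ for almost all $x\in\mathbf{R}^N$ and $0<t<T$. Such a solution $u$ is minimal in $\mathbf{R}^N\times[0,T)$ if $u(x,t)\le v(x,t)$ for almost all $x\in\mathbf{R}^N$ and $0<t<T$, for any solution $v$ of the same Cauchy problem in $\mathbf{R}^N\times[0,T)$. The minimal solution is unique, and $T(\mu)$ denotes its maximal existence time, i.e. the supremum of all $T\in(0,\infty]$ such that the minimal solution exists in $\mathbf{R}^N\times[0,T)$ (with $T(\mu)=\infty$, $\log T(\mu)=\infty$ allowed). *)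

theory Defs
  imports "HOL-Analysis.Analysis"
begin

text \<open>
  The Euclidean space \<open>R\<^sup>N\<close> is a type \<open>'a::euclidean_space\<close>, with \<open>N = DIM('a) \<ge> 1\<close>.
\<close>

(* Meant for open S: all partial derivatives of order up to k exist and are continuous, and
   those of order below k are Frechet differentiable. *)
primrec Ck_on :: "nat \<Rightarrow> ('b::euclidean_space \<Rightarrow> real) \<Rightarrow> 'b set \<Rightarrow> bool" where
  "Ck_on 0 f S \<longleftrightarrow> continuous_on S f"
| "Ck_on (Suc k) f S \<longleftrightarrow> f differentiable_on S \<and>
     (\<forall>b\<in>Basis. Ck_on k (\<lambda>x. frechet_derivative f (at x) b) S)"

definition smooth_on :: "('b::euclidean_space \<Rightarrow> real) \<Rightarrow> 'b set \<Rightarrow> bool" where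
  "smooth_on f S \<longleftrightarrow> (\<forall>k. Ck_on k f S)"

(* The kernel is determined for t > 0 by these conditions (continuity and uniqueness of the
   Fourier transform); its values for t <= 0 are never used. *)
definition fundamental_solution :: "real \<Rightarrow> ('a::euclidean_space \<Rightarrow> real \<Rightarrow> real) \<Rightarrow> bool" where
  "fundamental_solution \<theta> G \<longleftrightarrow>
     (\<forall>x. \<forall>t>0. 0 < G x t) \<and>
     smooth_on (\<lambda>(x, t). G x t) (UNIV \<times> {0<..}) \<and>
     (\<forall>t>0. integrable lebesgue (\<lambda>x. G x t)) \<and>
     (\<forall>t>0. \<forall>\<xi>. (LINT x|lebesgue. complex_of_real (G x t) * exp (- (\<i> * complex_of_real (\<xi> \<bullet> x))))
        = complex_of_real (exp (- t * norm \<xi> powr \<theta>)))"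

definition ennreal_powr :: "ennreal \<Rightarrow> real \<Rightarrow> ennreal" where
  "ennreal_powr a p = (if a = top then top else ennreal (enn2real a powr p))"

(* log 0 = -\<infinity>, log \<infinity> = \<infinity> *)
definition ln_ennreal :: "ennreal \<Rightarrow> ereal" where
  "ln_ennreal a = (if a = top then \<infinity> else if a = 0 then -\<infinity> else ereal (ln (enn2real a)))"

definition strip :: "ennreal \<Rightarrow> ('a::euclidean_space \<times> real) set" where
  "strip T = {(x, t). 0 < t \<and> ennreal t < T}"

(* Functions on the strip take values in [0, \<infinity>]; finiteness is part of the equation. The
   values of u outside strip T are irrelevant. *)
definition is_solution ::
  "real \<Rightarrow> ('a::euclidean_space \<Rightarrow> real \<Rightarrow> real) \<Rightarrow> 'a measure \<Rightarrow> ennreal \<Rightarrow> ('a \<Rightarrow> real \<Rightarrow> ennreal) \<Rightarrow> bool" where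
  "is_solution p G \<mu> T u \<longleftrightarrow>
     case_prod u \<in> borel_measurable (lebesgue_on (strip T)) \<and>
     (AE (x, t) in lebesgue. (x, t) \<in> strip T \<longrightarrow>
        u x t < \<infinity> \<and>
        u x t = (\<integral>\<^sup>+y. ennreal (G (x - y) t) \<partial>\<mu>)
          + (\<integral>\<^sup>+s\<in>{0<..<t}. (\<integral>\<^sup>+y. ennreal (G (x - y) (t - s)) * ennreal_powr (u y s) p \<partial>lebesgue) \<partial>lebesgue))"

definition is_minimal_solution ::
  "real \<Rightarrow> ('a::euclidean_space \<Rightarrow> real \<Rightarrow> real) \<Rightarrow> 'a measure \<Rightarrow> ennreal \<Rightarrow> ('a \<Rightarrow> real \<Rightarrow> ennreal) \<Rightarrow> bool" where
  "is_minimal_solution p G \<mu> T u \<longleftrightarrow>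
     is_solution p G \<mu> T u \<and>
     (\<forall>v. is_solution p G \<mu> T v \<longrightarrow>
        (AE (x, t) in lebesgue. (x, t) \<in> strip T \<longrightarrow> u x t \<le> v x t))"

(* The supremum is 0 if there is no solution for any T > 0. *)
definition max_existence_time ::
  "real \<Rightarrow> ('a::euclidean_space \<Rightarrow> real \<Rightarrow> real) \<Rightarrow> 'a measure \<Rightarrow> ennreal" where
  "max_existence_time p G \<mu> = Sup {T. 0 < T \<and> (\<exists>u. is_minimal_solution p G \<mu> T u)}"

definition function_measure :: "('a::euclidean_space \<Rightarrow> real) \<Rightarrow> 'a measure" where
  "function_measure f = density lebesgue (\<lambda>x. ennreal (f x))"

end

theory Submission
  imports Defs "HOL-Probability.Characteristic_Functions" "HOL-Real_Asymp.Real_Asymp"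
begin

text \<open>
  If \<open>U(t) = G(t) * \<mu>\<close> satisfies
  \<open>2\<^sup>p \<integral>\<^sub>0\<^sup>T (sup U(s))\<^sup>p\<^sup>-\<^sup>1 ds \<le> 1\<close>, then \<open>2 U\<close> is a supersolution on \<open>[0, T)\<close>, by
  \<open>G(t - s) * U(s) = U(t)\<close>, and it dominates the Picard iteration, whose limit is the
  minimal solution. For \<open>\<mu> = \<lambda> \<phi>\<close>, splitting the convolution at \<open>|y| = t\<^sup>1\<^sup>/\<^sup>\<theta>\<close> gives
  \<open>sup U(t) \<le> C \<lambda> (1 + t) powr (- min A N / \<theta>)\<close>, with an extra logarithm when \<open>A = N\<close>, and the
  resulting integral condition on \<open>T\<close> yields all four lower bounds. About \<open>G\<close> this only uses
  the total mass, the semigroup property and \<open>G(x, t) \<le> C t powr (- N / \<theta>)\<close>; all three are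
  read off the Fourier transform by means of the inversion formula.
\<close>

section \<open>Gaussians and Fourier inversion\<close>

text \<open>In general G has no closed formula, and the hypotheses on it fix little beyond
  positivity, smoothness and the Fourier transform. The estimates are therefore arranged so that no
  decay of G in x is needed: near the origin the supremum of the kernel pays, far away its total
  mass. All four bounds come from one inequality between numbers, (\<lambda> L(T))^(p-1) I(T) \<le>
  \<kappa>. Here L is a logarithmic factor, equal to 1 unless A = N, and I(T) is the integral of (1
  + s)^(-q) over [0, T] with q = min(A, N) (p - 1) / \<theta>. The critical case is q = 1, where I
  is a logarithm and T may be exponentially large; the subcritical case is q < 1, where I grows like
  a power of T. Each bound is obtained by inserting an explicit T into this inequality. A side
  condition on the whole proof is measurability: the definitions speak of Lebesgue measure and of
  almost every point, whereas Tonelli's theorem is applied to Borel functions on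
  \<open>lborel\<close>. The construction is carried out with Borel data at every point and
  transferred at the end.\<close>

lemma nn_integral_lborel_affine:
  fixes f :: "'a::euclidean_space \<Rightarrow> ennreal"
  assumes [measurable]: "f \<in> borel_measurable borel" and "c \<noteq> 0"
  shows "(\<integral>\<^sup>+x. f x \<partial>lborel) = ennreal (\<bar>c\<bar> ^ DIM('a)) * (\<integral>\<^sup>+x. f (t + c *\<^sub>R x) \<partial>lborel)"
  using assms(2)
  by (subst lborel_affine[of c t]) (auto simp: nn_integral_density nn_integral_distr nn_integral_cmult ennreal_power)

lemma integral_lborel_affine:
  fixes f :: "'a::euclidean_space \<Rightarrow> 'b::{banach, second_countable_topology}"
  assumes [measurable]: "f \<in> borel_measurable borel" and "c \<noteq> 0"
  shows "(\<integral>x. f x \<partial>lborel) = \<bar>c\<bar> ^ DIM('a) *\<^sub>R (\<integral>x. f (t + c *\<^sub>R x) \<partial>lborel)"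
  using assms(2)
  by (subst lborel_affine[of c t]) (auto simp: integral_density integral_distr)

lemma integrable_lborel_affine:
  fixes f :: "'a::euclidean_space \<Rightarrow> 'b::{banach, second_countable_topology}"
  assumes "integrable lborel f" and "c \<noteq> 0"
  shows "integrable lborel (\<lambda>x. f (t + c *\<^sub>R x))"
proof -
  have [measurable]: "f \<in> borel_measurable borel" using assms by auto
  have "integrable lborel (\<lambda>x. \<bar>c\<bar> ^ DIM('a) *\<^sub>R f (t + c *\<^sub>R x))" using assms
    by (subst (asm) lborel_affine[of c t]) (auto simp: integrable_density integrable_distr_eq)
  from integrable_scaleR_right[OF this, of "1 / \<bar>c\<bar> ^ DIM('a)"] show ?thesis using assms by simp
qed

lemma gaussian_fourier_real:
  fixes v :: real
  shows "integrable lborel (\<lambda>x. complex_of_real (exp (- x\<^sup>2 / 2)) * iexp (x * v))"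
    and "(\<integral>x. complex_of_real (exp (- x\<^sup>2 / 2)) * iexp (x * v) \<partial>lborel) = of_real (sqrt (2 * pi) * exp (- v\<^sup>2 / 2))"
proof -
  have *: "complex_of_real (exp (- x\<^sup>2 / 2)) * iexp (x * v) = of_real (sqrt (2 * pi)) * (std_normal_density x *\<^sub>R iexp (v * x))" for x
    by (simp add: std_normal_density_def scaleR_conv_of_real mult.commute)
  have int: "integrable lborel (\<lambda>x. std_normal_density x *\<^sub>R iexp (v * x))"
    by (rule Bochner_Integration.integrable_bound[OF integrable_normal_density[of 1 0]]) (auto simp: norm_mult)
  show "integrable lborel (\<lambda>x. complex_of_real (exp (- x\<^sup>2 / 2)) * iexp (x * v))"
    unfolding * using int by (intro integrable_mult_right)
  have "(\<integral>x. std_normal_density x *\<^sub>R iexp (v * x) \<partial>lborel) = char std_normal_distribution v"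
    unfolding char_def by (subst integral_density) auto
  then show "(\<integral>x. complex_of_real (exp (- x\<^sup>2 / 2)) * iexp (x * v) \<partial>lborel) = of_real (sqrt (2 * pi) * exp (- v\<^sup>2 / 2))"
    unfolding * integral_mult_right_zero char_std_normal_distribution by simp
qed

text \<open>The Gaussian and the character both factor over the coordinates, so on the product
  measure underlying \<open>lborel\<close> the integral is a product of one-dimensional
  characteristic functions of the normal law.\<close>

lemma gaussian_fourier:
  fixes v :: "'a::euclidean_space"
  shows "integrable lborel (\<lambda>x::'a. complex_of_real (exp (- (norm x)\<^sup>2 / 2)) * iexp (x \<bullet> v))" (is "integrable _ ?F")
    and "(\<integral>x. complex_of_real (exp (- (norm x)\<^sup>2 / 2)) * iexp (x \<bullet> v) \<partial>lborel) =
           of_real (sqrt (2 * pi) ^ DIM('a) * exp (- (norm v)\<^sup>2 / 2))"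
proof -
  interpret product_sigma_finite "\<lambda>_::'a. lborel :: real measure" ..
  let ?P = "Pi\<^sub>M Basis (\<lambda>_::'a. lborel :: real measure)"
  let ?S = "\<lambda>f. \<Sum>b\<in>Basis. f b *\<^sub>R b :: 'a"
  define h where "h b t = complex_of_real (exp (- t\<^sup>2 / 2)) * iexp (t * (v \<bullet> b))" for b :: 'a and t :: real
  have prod: "?F (?S f) = (\<Prod>b\<in>Basis. h b (f b))" for f
  proof -
    have 1: "(norm (?S f))\<^sup>2 = (\<Sum>b\<in>Basis. (f b)\<^sup>2)"
      unfolding power2_norm_eq_inner euclidean_inner[of "?S f" "?S f"]
      by (intro sum.cong) (auto simp: inner_sum_left_Basis power2_eq_square)
    have 2: "?S f \<bullet> v = (\<Sum>b\<in>Basis. f b * (v \<bullet> b))"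
      unfolding inner_sum_left by (intro sum.cong) (auto simp: inner_commute)
    show ?thesis
      unfolding 1 2 h_def prod.distrib
      by (simp add: exp_sum sum_negf sum_divide_distrib[symmetric] sum_distrib_left flip: exp_sum exp_of_real of_real_prod)
  qed
  have hint: "integrable lborel (h b)" for b
    unfolding h_def by (rule gaussian_fourier_real)
  have "integrable ?P (\<lambda>f. ?F (?S f))"
    unfolding prod by (rule product_integrable_prod) (auto intro: hint)
  then show "integrable lborel ?F"
    by (subst lborel_eq, subst integrable_distr_eq) auto
  have "(\<integral>x. ?F x \<partial>lborel) = (\<integral>f. ?F (?S f) \<partial>?P)"
    by (subst lborel_eq, subst integral_distr) auto
  also have "\<dots> = (\<Prod>b\<in>Basis. \<integral>t. h b t \<partial>lborel)"
    unfolding prod by (rule product_integral_prod) (auto intro: hint)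
  also have "\<dots> = (\<Prod>b\<in>(Basis::'a set). of_real (sqrt (2 * pi) * exp (- (v \<bullet> b)\<^sup>2 / 2)))"
    unfolding h_def by (simp only: gaussian_fourier_real)
  also have "\<dots> = of_real (sqrt (2 * pi) ^ DIM('a) * exp (- (norm v)\<^sup>2 / 2))"
  proof -
    have "(norm v)\<^sup>2 = (\<Sum>b\<in>Basis. (v \<bullet> b)\<^sup>2)"
      unfolding power2_norm_eq_inner euclidean_inner[of v v] by (simp add: power2_eq_square)
    then show ?thesis
      by (simp add: prod.distrib exp_sum sum_negf sum_divide_distrib[symmetric] flip: of_real_prod exp_sum)
  qed
  finally show "(\<integral>x. ?F x \<partial>lborel) = of_real (sqrt (2 * pi) ^ DIM('a) * exp (- (norm v)\<^sup>2 / 2))" .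
qed

section \<open>The multiplication formula and Fourier inversion\<close>

lemma integrable_product_lborel:
  fixes f :: "'a::euclidean_space \<Rightarrow> real" and g :: "'b::euclidean_space \<Rightarrow> real"
  assumes "integrable lborel f" "integrable lborel g"
  shows "integrable (lborel \<Otimes>\<^sub>M lborel) (\<lambda>(x, y). f x * g y)"
proof -
  have [measurable]: "f \<in> borel_measurable borel" "g \<in> borel_measurable borel"
    using assms by auto
  show ?thesis
    by (rule lborel_pair.Fubini_integrable) (use assms in \<open>auto simp: abs_mult\<close>)
qed

text \<open>Absolute integrability of f(y) g(\<xi>) permits Fubini, which moves the transform from f
  onto the weight g. This serves twice: with a Gaussian weight for inversion, and with the symbol of
  the kernel for the semigroup property.\<close>

lemma fourier_integral_swap:
  fixes f g :: "'a::euclidean_space \<Rightarrow> real"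
  assumes f: "integrable lborel f" and g: "integrable lborel g"
  shows "(\<integral>\<xi>. (\<integral>y. complex_of_real (f y) * exp (- (\<i> * of_real (\<xi> \<bullet> y))) \<partial>lborel) * (of_real (g \<xi>) * iexp (\<xi> \<bullet> x)) \<partial>lborel) =
    (\<integral>y. complex_of_real (f y) * (\<integral>\<xi>. of_real (g \<xi>) * iexp (\<xi> \<bullet> (x - y)) \<partial>lborel) \<partial>lborel)"
proof -
  have [measurable]: "f \<in> borel_measurable borel" "g \<in> borel_measurable borel"
    using assms by auto
  let ?h = "\<lambda>\<xi> y. complex_of_real (f y) * (of_real (g \<xi>) * iexp (\<xi> \<bullet> (x - y)))"
  have "integrable (lborel \<Otimes>\<^sub>M lborel) (case_prod ?h)"
    by (rule Bochner_Integration.integrable_bound[OF integrable_product_lborel[OF g f]])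
       (auto simp: norm_mult abs_mult split_beta)
  from lborel_pair.Fubini_integral[OF this]
  have "(\<integral>\<xi>. \<integral>y. ?h \<xi> y \<partial>lborel \<partial>lborel) = (\<integral>y. \<integral>\<xi>. ?h \<xi> y \<partial>lborel \<partial>lborel)" by simp
  moreover have "?h \<xi> y = complex_of_real (f y) * exp (- (\<i> * of_real (\<xi> \<bullet> y))) * (of_real (g \<xi>) * iexp (\<xi> \<bullet> x))" for \<xi> y
  proof -
    have "iexp (\<xi> \<bullet> (x - y)) = exp (- (\<i> * of_real (\<xi> \<bullet> y))) * iexp (\<xi> \<bullet> x)"
      by (simp add: inner_diff_right algebra_simps flip: exp_add)
    then show ?thesis by simp
  qed
  then have "(\<integral>\<xi>. (\<integral>y. complex_of_real (f y) * exp (- (\<i> * of_real (\<xi> \<bullet> y))) \<partial>lborel) * (of_real (g \<xi>) * iexp (\<xi> \<bullet> x)) \<partial>lborel) =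
      (\<integral>\<xi>. \<integral>y. ?h \<xi> y \<partial>lborel \<partial>lborel)"
    by (simp only: integral_mult_left_zero)
  moreover have "(\<integral>y. \<integral>\<xi>. ?h \<xi> y \<partial>lborel \<partial>lborel) =
      (\<integral>y. complex_of_real (f y) * (\<integral>\<xi>. of_real (g \<xi>) * iexp (\<xi> \<bullet> (x - y)) \<partial>lborel) \<partial>lborel)"
    by (simp only: integral_mult_right_zero)
  ultimately show ?thesis
    by simp
qed

text \<open>Gaussian damping makes the inversion integral converge absolutely for every integrable
  f, and the result is an average of f near z at scale c. In the variable w the Gaussian is fixed
  and c enters only through the argument of f, the form in which c can tend to 0.\<close>

lemma fourier_gaussian_smoothing:
  fixes f :: "'a::euclidean_space \<Rightarrow> real"
  assumes f: "integrable lborel f" and c: "c > 0"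
  shows "(\<integral>\<xi>. (\<integral>y. complex_of_real (f y) * exp (- (\<i> * of_real (\<xi> \<bullet> y))) \<partial>lborel) *
      (of_real (exp (- (norm (c *\<^sub>R \<xi>))\<^sup>2 / 2)) * iexp (\<xi> \<bullet> z)) \<partial>lborel) =
    of_real (sqrt (2 * pi) ^ DIM('a) * (\<integral>w. f (z - c *\<^sub>R w) * exp (- (norm w)\<^sup>2 / 2) \<partial>lborel))"
proof -
  have [measurable]: "f \<in> borel_measurable borel" using f by auto
  let ?K = "sqrt (2 * pi) ^ DIM('a)"
  let ?E = "\<lambda>x::'a. exp (- (norm x)\<^sup>2 / 2)"
  have "integrable lborel (\<lambda>x::'a. complex_of_real (?E x))"
    using gaussian_fourier(1)[of "0::'a"] by simp
  then have E: "integrable lborel ?E"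
    unfolding complex_of_real_integrable_eq .
  have Ec: "integrable lborel (\<lambda>\<xi>. ?E (c *\<^sub>R \<xi>))"
    using integrable_lborel_affine[OF E, of c 0] c by simp
  have inner: "(\<integral>\<xi>. of_real (?E (c *\<^sub>R \<xi>)) * iexp (\<xi> \<bullet> (z - y)) \<partial>lborel) =
      of_real ((1 / c) ^ DIM('a) * ?K * ?E ((1 / c) *\<^sub>R (z - y)))" for y
  proof -
    have "(\<integral>\<xi>. of_real (?E (c *\<^sub>R \<xi>)) * iexp (\<xi> \<bullet> (z - y)) \<partial>lborel) =
        (1 / c) ^ DIM('a) *\<^sub>R (\<integral>\<xi>. of_real (?E \<xi>) * iexp (\<xi> \<bullet> ((1 / c) *\<^sub>R (z - y))) \<partial>lborel)"
      using c by (subst integral_lborel_affine[of _ "1 / c" 0]) simp_all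
    then show ?thesis
      unfolding gaussian_fourier(2) by (simp add: scaleR_conv_of_real)
  qed
  have "(\<integral>y. complex_of_real (f y) * (\<integral>\<xi>. of_real (?E (c *\<^sub>R \<xi>)) * iexp (\<xi> \<bullet> (z - y)) \<partial>lborel) \<partial>lborel) =
     of_real (\<integral>y. f y * ((1 / c) ^ DIM('a) * ?K * ?E ((1 / c) *\<^sub>R (z - y))) \<partial>lborel)"
    unfolding inner by (simp flip: integral_complex_of_real of_real_mult)
  also have "(\<integral>y. f y * ((1 / c) ^ DIM('a) * ?K * ?E ((1 / c) *\<^sub>R (z - y))) \<partial>lborel) =
     ?K * (\<integral>w. f (z - c *\<^sub>R w) * ?E w \<partial>lborel)"
  proof -
    have *: "(1 / c) *\<^sub>R (z - (z + - c *\<^sub>R w)) = w" for w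
      using c by simp
    have "(\<integral>y. f y * ((1 / c) ^ DIM('a) * ?K * ?E ((1 / c) *\<^sub>R (z - y))) \<partial>lborel) =
        \<bar>- c\<bar> ^ DIM('a) *\<^sub>R (\<integral>w. f (z + - c *\<^sub>R w) * ((1 / c) ^ DIM('a) * ?K * ?E w) \<partial>lborel)"
      using c by (subst integral_lborel_affine[of _ "- c" z]) (simp_all only: *, auto)
    also have "(\<lambda>w. f (z + - c *\<^sub>R w) * ((1 / c) ^ DIM('a) * ?K * ?E w)) =
        (\<lambda>w. (1 / c) ^ DIM('a) * ?K * (f (z - c *\<^sub>R w) * ?E w))"
      by (simp add: fun_eq_iff)
    finally show ?thesis
      using c by (simp only: integral_mult_right_zero) (simp add: power_divide)
  qed
  finally show ?thesis
    unfolding fourier_integral_swap[OF f Ec] .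
qed

text \<open>
  A first passage to the limit along shrinking Gaussians, by Fatou's lemma, bounds \<open>f\<close>; this
  bound dominates the integrand in the second passage to the limit.
\<close>
lemma fourier_inversion:
  fixes f F :: "'a::euclidean_space \<Rightarrow> real"
  assumes f: "integrable lborel f" and cont: "continuous_on UNIV f" and nn: "\<And>x. 0 \<le> f x"
    and F: "integrable lborel F"
    and eq: "\<And>\<xi>. (\<integral>y. complex_of_real (f y) * exp (- (\<i> * of_real (\<xi> \<bullet> y))) \<partial>lborel) = of_real (F \<xi>)"
  shows "of_real ((2 * pi) ^ DIM('a) * f z) = (\<integral>\<xi>. of_real (F \<xi>) * iexp (\<xi> \<bullet> z) \<partial>lborel)"
    and "(2 * pi) ^ DIM('a) * f z \<le> (\<integral>\<xi>. \<bar>F \<xi>\<bar> \<partial>lborel)"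
proof -
  have [measurable]: "f \<in> borel_measurable borel" "F \<in> borel_measurable borel" using f F by auto
  let ?K = "sqrt (2 * pi) ^ DIM('a)"
  let ?E = "\<lambda>x::'a. exp (- (norm x)\<^sup>2 / 2)"
  let ?c = "\<lambda>n. inverse (real (Suc n))"
  have K: "?K * ?K = (2 * pi) ^ DIM('a)" "?K > 0"
    unfolding power_mult_distrib[symmetric] by simp_all
  have "integrable lborel (\<lambda>x::'a. complex_of_real (?E x))"
    using gaussian_fourier(1)[of "0::'a"] by simp
  then have E: "integrable lborel ?E"
    unfolding complex_of_real_integrable_eq .
  have "complex_of_real (\<integral>x. ?E x \<partial>lborel) = of_real ?K"
    using gaussian_fourier(2)[of "0::'a"] by (simp flip: integral_complex_of_real)
  then have intE: "(\<integral>x. ?E x \<partial>lborel) = ?K"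
    using of_real_eq_iff by blast
  \<comment> \<open>An average of f around z at scale 1/(n+1), so its limit is f(z) times the
    Gaussian mass \<open>?K\<close>.\<close>
  define S where "S n z = (\<integral>w. f (z - ?c n *\<^sub>R w) * ?E w \<partial>lborel)" for n z
  define M where "M = (\<integral>\<xi>. \<bar>F \<xi>\<bar> \<partial>lborel)"
  have smooth: "(\<integral>\<xi>. of_real (F \<xi>) * (of_real (?E (?c n *\<^sub>R \<xi>)) * iexp (\<xi> \<bullet> z)) \<partial>lborel) = complex_of_real (?K * S n z)" for n z
    using fourier_gaussian_smoothing[OF f, of "?c n" z] unfolding eq S_def by simp
  have E1: "?E x \<le> 1" for x :: 'a by simp
  have Sint: "integrable lborel (\<lambda>w. f (z - ?c n *\<^sub>R w) * ?E w)" for n z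
  proof (rule Bochner_Integration.integrable_bound)
    show "integrable lborel (\<lambda>w. f (z - ?c n *\<^sub>R w))"
      using integrable_lborel_affine[OF f, of "- ?c n" z] by simp
  qed (auto simp: norm_mult nn intro!: mult_left_le)
  have SM: "?K * S n z \<le> M" for n z
  proof -
    have "?K * S n z \<le> norm (complex_of_real (?K * S n z))" unfolding norm_of_real by simp
    also have "\<dots> \<le> (\<integral>\<xi>. \<bar>F \<xi>\<bar> \<partial>lborel)"
      unfolding smooth[symmetric]
    proof (intro order_trans[OF integral_norm_bound integral_mono] integrable_norm)
      have "integrable lborel (\<lambda>\<xi>. complex_of_real (F \<xi>))" using F by simp
      then show "integrable lborel (\<lambda>\<xi>. complex_of_real (F \<xi>) * (of_real (?E (?c n *\<^sub>R \<xi>)) * iexp (\<xi> \<bullet> z)))"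
        by (rule Bochner_Integration.integrable_bound) (auto simp: norm_mult intro!: mult_left_le)
    qed (use F in \<open>auto simp: norm_mult intro!: mult_left_le\<close>)
    finally show ?thesis unfolding M_def .
  qed
  have lim: "(\<lambda>n. f (z - ?c n *\<^sub>R w)) \<longlonglongrightarrow> f z" for z w
  proof -
    have "(\<lambda>n. z - ?c n *\<^sub>R w) \<longlonglongrightarrow> z - 0 *\<^sub>R w"
      by (intro tendsto_intros LIMSEQ_inverse_real_of_nat)
    then show ?thesis
      using cont by (auto simp: continuous_on_eq_continuous_at isCont_def intro!: isCont_tendsto_compose[of _ f])
  qed
  have bound: "?K * ?K * f z \<le> M" for z
  proof -
    have "(\<integral>\<^sup>+w. ennreal (f z * ?E w) \<partial>lborel) = (\<integral>\<^sup>+w. liminf (\<lambda>n. ennreal (f (z - ?c n *\<^sub>R w) * ?E w)) \<partial>lborel)"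
      by (intro nn_integral_cong lim_imp_Liminf[symmetric] tendsto_ennrealI tendsto_mult lim) auto
    also have "\<dots> \<le> liminf (\<lambda>n. \<integral>\<^sup>+w. ennreal (f (z - ?c n *\<^sub>R w) * ?E w) \<partial>lborel)"
      by (rule nn_integral_liminf) simp
    also have "\<dots> = liminf (\<lambda>n. ennreal (S n z))"
      unfolding S_def by (subst nn_integral_eq_integral[OF Sint]) (auto simp: nn)
    also have "\<dots> \<le> liminf (\<lambda>n. ennreal (M / ?K))"
      using SM K(2) by (intro Liminf_mono always_eventually allI ennreal_leI) (simp add: field_simps)
    finally have "(\<integral>\<^sup>+w. ennreal (f z * ?E w) \<partial>lborel) \<le> ennreal (M / ?K)"
      by (simp add: Liminf_const)
    also have "(\<integral>\<^sup>+w. ennreal (f z * ?E w) \<partial>lborel) = ennreal (f z * ?K)"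
      using E intE nn by (subst nn_integral_eq_integral) auto
    finally show ?thesis
      using K(2) by (subst (asm) ennreal_le_iff) (auto simp: M_def field_simps intro!: divide_nonneg_nonneg)
  qed
  then show "(2 * pi) ^ DIM('a) * f z \<le> (\<integral>\<xi>. \<bar>F \<xi>\<bar> \<partial>lborel)"
    unfolding K M_def .
  have "(\<lambda>n. S n z) \<longlonglongrightarrow> (\<integral>w. f z * ?E w \<partial>lborel)"
    unfolding S_def
  proof (rule integral_dominated_convergence)
    show "integrable lborel (\<lambda>w. M / (?K * ?K) * ?E w)" using E by (rule integrable_mult_right)
    show "AE w in lborel. norm (f (z - ?c n *\<^sub>R w) * ?E w) \<le> M / (?K * ?K) * ?E w" for n
      using bound[of "z - ?c n *\<^sub>R _"] K(2) nn
      by (intro AE_I2) (auto simp: norm_mult mult_ac pos_le_divide_eq intro!: mult_right_mono)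
    show "AE w in lborel. (\<lambda>n. f (z - ?c n *\<^sub>R w) * ?E w) \<longlonglongrightarrow> f z * ?E w"
      by (intro AE_I2 tendsto_mult lim) auto
  qed auto
  then have "(\<lambda>n. S n z) \<longlonglongrightarrow> f z * ?K"
    unfolding integral_mult_right_zero intE .
  then have "(\<lambda>n. complex_of_real (?K * S n z)) \<longlonglongrightarrow> of_real (?K * (f z * ?K))"
    by (intro tendsto_of_real tendsto_mult tendsto_const)
  \<comment> \<open>The same sequence seen on the frequency side: the damping tends to 1 and
    \<open>\<bar>F \<xi>\<bar>\<close> dominates. Uniqueness of limits then identifies the two
    sides.\<close>
  moreover have "(\<lambda>n. \<integral>\<xi>. of_real (F \<xi>) * (of_real (?E (?c n *\<^sub>R \<xi>)) * iexp (\<xi> \<bullet> z)) \<partial>lborel)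
      \<longlonglongrightarrow> (\<integral>\<xi>. of_real (F \<xi>) * (of_real 1 * iexp (\<xi> \<bullet> z)) \<partial>lborel)"
  proof (rule integral_dominated_convergence)
    show "integrable lborel (\<lambda>\<xi>. \<bar>F \<xi>\<bar>)" using F by simp
    show "AE \<xi> in lborel. (\<lambda>n. complex_of_real (F \<xi>) * (of_real (?E (?c n *\<^sub>R \<xi>)) * iexp (\<xi> \<bullet> z)))
        \<longlonglongrightarrow> of_real (F \<xi>) * (of_real 1 * iexp (\<xi> \<bullet> z))"
    proof (intro AE_I2 tendsto_mult tendsto_of_real tendsto_const)
      fix \<xi> :: 'a
      have "(\<lambda>n. ?E (?c n *\<^sub>R \<xi>)) \<longlonglongrightarrow> ?E (0 *\<^sub>R \<xi>)"
        by (intro tendsto_intros LIMSEQ_inverse_real_of_nat) auto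
      then show "(\<lambda>n. ?E (?c n *\<^sub>R \<xi>)) \<longlonglongrightarrow> 1" by simp
    qed
  qed (auto simp: norm_mult intro!: mult_left_le)
  ultimately have "of_real (?K * (f z * ?K)) = (\<integral>\<xi>. of_real (F \<xi>) * (of_real 1 * iexp (\<xi> \<bullet> z)) \<partial>lborel)"
    unfolding smooth using LIMSEQ_unique by blast
  moreover have "?K * (f z * ?K) = (2 * pi) ^ DIM('a) * f z"
    unfolding K(1)[symmetric] by (simp only: mult_ac)
  ultimately show "of_real ((2 * pi) ^ DIM('a) * f z) = (\<integral>\<xi>. of_real (F \<xi>) * iexp (\<xi> \<bullet> z) \<partial>lborel)"
    by simp
qed

section \<open>Radial integrals\<close>

lemma nn_integral_one_plus_powr:
  fixes a b k :: real
  assumes "0 \<le> a" "a \<le> b" "k \<noteq> 0"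
  shows "(\<integral>\<^sup>+r. ennreal ((1 + r) powr (k - 1)) * indicator {a..b} r \<partial>lborel) =
    ennreal ((1 + b) powr k / k - (1 + a) powr k / k)"
proof (rule nn_integral_FTC_Icc)
  show "((\<lambda>r. (1 + r) powr k / k) has_real_derivative (1 + x) powr (k - 1)) (at x)"
    if "x \<in> {a..b}" for x
    using assms that by (auto intro!: derivative_eq_intros)
qed (use assms in auto)

lemma nn_integral_one_plus_inverse:
  fixes b :: real
  assumes "0 \<le> b"
  shows "(\<integral>\<^sup>+r. ennreal ((1 + r) powr -1) * indicator {0..b} r \<partial>lborel) = ennreal (ln (1 + b))"
proof -
  have "(\<integral>\<^sup>+r. ennreal ((1 + r) powr -1) * indicator {0..b} r \<partial>lborel) = ennreal (ln (1 + b) - ln (1 + 0))"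
  proof (rule nn_integral_FTC_Icc)
    show "((\<lambda>r. ln (1 + r)) has_real_derivative (1 + x) powr -1) (at x)"
      if "x \<in> {0..b}" for x
      using assms that by (auto intro!: derivative_eq_intros simp: powr_minus_divide)
  qed (use assms in auto)
  then show ?thesis by simp
qed

text \<open>Layer-cake representation of the weight \<open>(1 + norm y) powr (- A)\<close> on the ball.\<close>
lemma nn_integral_ball_weight_le:
  fixes A R :: real
  assumes A: "0 < A" and R: "0 \<le> R"
  shows "(\<integral>\<^sup>+y. ennreal ((1 + norm (y::'a::euclidean_space)) powr (- A)) * indicator (ball 0 R) y \<partial>lborel)
    \<le> ennreal (unit_ball_vol DIM('a)) * (ennreal ((1 + R) powr (DIM('a) - A)) +
        ennreal A * (\<integral>\<^sup>+r. ennreal ((1 + r) powr (DIM('a) - A - 1)) * indicator {0..R} r \<partial>lborel))"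
proof -
  let ?w = "unit_ball_vol (real DIM('a))"
  let ?h = "\<lambda>r::real. ennreal (A * (1 + r) powr (- A - 1))"
  let ?c = "ennreal ((1 + R) powr (- A))"
  let ?J = "\<lambda>r (y::'a). indicator {z. norm (snd z) \<le> fst z} (r, y) :: ennreal"
  have w: "0 \<le> ?w" by simp
  have J: "(\<lambda>z::'a \<times> real. ?h (snd z) * indicator {0..R} (snd z) * ?J (snd z) (fst z)) \<in> borel_measurable (lborel \<Otimes>\<^sub>M lborel)"
    by measurable
  have inner_measurable: "(\<lambda>y. \<integral>\<^sup>+r. ?h r * indicator {0..R} r * ?J r y \<partial>lborel) \<in> borel_measurable lborel"
    using lborel.borel_measurable_nn_integral_fst[OF J] by simp
  \<comment> \<open>By the fundamental theorem of calculus, (1 + |y|)^(-A) is its value at R plus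
    the integral of A (1 + r)^(-A-1) over [|y|, R].\<close>
  have layer: "ennreal ((1 + norm y) powr (- A)) * indicator (ball 0 R) y \<le>
      ?c * indicator (cball 0 R) y + (\<integral>\<^sup>+r. ?h r * indicator {0..R} r * ?J r y \<partial>lborel)" for y :: 'a
  proof (cases "norm y < R")
    case True
    have "(\<integral>\<^sup>+r. ?h r * indicator {0..R} r * ?J r y \<partial>lborel) =
        (\<integral>\<^sup>+r. ?h r * indicator {norm y..R} r \<partial>lborel)"
      by (intro nn_integral_cong) (auto simp: indicator_def intro: order_trans[OF norm_ge_zero])
    also have "\<dots> = ennreal A * (\<integral>\<^sup>+r. ennreal ((1 + r) powr (- A - 1)) * indicator {norm y..R} r \<partial>lborel)"
      using A by (subst nn_integral_cmult[symmetric]) (auto simp: ennreal_mult mult.assoc)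
    also have "\<dots> = ennreal A * ennreal ((1 + R) powr (- A) / (- A) - (1 + norm y) powr (- A) / (- A))"
      using A True by (subst nn_integral_one_plus_powr) auto
    also have "\<dots> = ennreal ((1 + norm y) powr (- A) - (1 + R) powr (- A))"
      using A by (subst ennreal_mult'[symmetric]) (auto simp: right_diff_distrib)
    finally have "?c + (\<integral>\<^sup>+r. ?h r * indicator {0..R} r * ?J r y \<partial>lborel) = ennreal ((1 + norm y) powr (- A))"
      using A True powr_mono2'[of "- A" "1 + norm y" "1 + R"] add_pos_nonneg[OF zero_less_one norm_ge_zero, of y] by (simp add: ennreal_plus[symmetric] del: ennreal_plus)
    then show ?thesis using True by (simp add: indicator_def)
  qed auto
  have "(\<integral>\<^sup>+y. ennreal ((1 + norm (y::'a)) powr (- A)) * indicator (ball 0 R) y \<partial>lborel) \<le>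
      (\<integral>\<^sup>+y. ?c * indicator (cball (0::'a) R) y + (\<integral>\<^sup>+r. ?h r * indicator {0..R} r * ?J r y \<partial>lborel) \<partial>lborel)"
    by (intro nn_integral_mono layer)
  also have "\<dots> = ?c * emeasure lborel (cball (0::'a) R) +
      (\<integral>\<^sup>+y. (\<integral>\<^sup>+r. ?h r * indicator {0..R} r * ?J r y \<partial>lborel) \<partial>lborel)"
    by (subst nn_integral_add[OF _ inner_measurable]) (simp_all only: nn_integral_cmult_indicator borel_measurable_const borel_measurable_times_ennreal borel_measurable_indicator borel_closed closed_cball sets_lborel measurable_lborel1)
  \<comment> \<open>Integrating in y first leaves the volume of the ball of radius r, a substitute
    for polar coordinates.\<close>
  also have "(\<integral>\<^sup>+y. (\<integral>\<^sup>+r. ?h r * indicator {0..R} r * ?J r y \<partial>lborel) \<partial>lborel) =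
      (\<integral>\<^sup>+r. (\<integral>\<^sup>+y. ?h r * indicator {0..R} r * ?J r y \<partial>lborel) \<partial>lborel)"
    by (rule lborel_pair.Fubini') (simp add: split_beta')
  also have "\<dots> = (\<integral>\<^sup>+r. ?h r * indicator {0..R} r * ennreal (?w * r ^ DIM('a)) \<partial>lborel)"
  proof (intro nn_integral_cong)
    fix r :: real
    have "(\<integral>\<^sup>+y. ?h r * indicator {0..R} r * ?J r y \<partial>lborel) =
        (\<integral>\<^sup>+y. ?h r * indicator {0..R} r * indicator (cball 0 r) (y::'a) \<partial>lborel)"
      by (intro nn_integral_cong) (auto simp: indicator_def)
    also have "\<dots> = ?h r * indicator {0..R} r * emeasure lborel (cball (0::'a) r)"
      by (rule nn_integral_cmult_indicator) simp
    also have "\<dots> = ?h r * indicator {0..R} r * ennreal (?w * r ^ DIM('a))"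
      by (cases "0 \<le> r") (auto simp: emeasure_cball indicator_def)
    finally show "(\<integral>\<^sup>+y. ?h r * indicator {0..R} r * ?J r y \<partial>lborel) = \<dots>" .
  qed
  also have "\<dots> \<le> (\<integral>\<^sup>+r. ennreal (?w * A) * (ennreal ((1 + r) powr (DIM('a) - A - 1)) * indicator {0..R} r) \<partial>lborel)"
  proof (intro nn_integral_mono)
    fix r :: real
    show "?h r * indicator {0..R} r * ennreal (?w * r ^ DIM('a)) \<le>
        ennreal (?w * A) * (ennreal ((1 + r) powr (DIM('a) - A - 1)) * indicator {0..R} r)"
    proof (cases "r \<in> {0..R}")
      case True
      then have "(1 + r) powr (- A - 1) * r ^ DIM('a) \<le> (1 + r) powr (- A - 1) * (1 + r) ^ DIM('a)"
        by (intro mult_left_mono power_mono) auto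
      also have "\<dots> = (1 + r) powr (DIM('a) - A - 1)"
        using True by (simp add: algebra_simps flip: powr_realpow powr_add)
      finally have "A * ?w * ((1 + r) powr (- A - 1) * r ^ DIM('a)) \<le> A * ?w * (1 + r) powr (DIM('a) - A - 1)"
        using A w by (intro mult_left_mono) auto
      then show ?thesis
        using True A w by (simp add: mult_ac flip: ennreal_mult)
    qed simp
  qed
  also have "\<dots> = ennreal ?w * (ennreal A * (\<integral>\<^sup>+r. ennreal ((1 + r) powr (DIM('a) - A - 1)) * indicator {0..R} r \<partial>lborel))"
    using A w by (subst nn_integral_cmult) (auto simp: ennreal_mult mult.assoc)
  also have "?c * emeasure lborel (cball (0::'a) R) \<le> ennreal ?w * ennreal ((1 + R) powr (DIM('a) - A))"
  proof -
    have "(1 + R) powr (- A) * R ^ DIM('a) \<le> (1 + R) powr (- A) * (1 + R) ^ DIM('a)"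
      using R by (intro mult_left_mono power_mono) auto
    also have "\<dots> = (1 + R) powr (DIM('a) - A)"
      using R by (simp add: algebra_simps flip: powr_realpow powr_add)
    finally have "?w * ((1 + R) powr (- A) * R ^ DIM('a)) \<le> ?w * (1 + R) powr (DIM('a) - A)"
      using w by (rule mult_left_mono)
    then show ?thesis
      using R w by (simp add: emeasure_cball mult_ac flip: ennreal_mult)
  qed
  finally show ?thesis
    by (simp add: distrib_left add_mono)
qed

text \<open>A single term of the exponential series already beats the given power: choose k with
  \<theta> k \<ge> q.\<close>

lemma exp_neg_powr_le:
  fixes \<theta> q :: real
  assumes \<theta>: "0 < \<theta>" and "0 \<le> q"
  obtains C where "0 < C" "\<And>x. 0 \<le> x \<Longrightarrow> exp (- (x powr \<theta>)) \<le> C * (1 + x) powr (- q)"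
proof -
  obtain k :: nat where k: "q \<le> \<theta> * real k"
    using reals_Archimedean3[OF \<theta>] by (metis less_imp_le mult.commute)
  \<comment> \<open>\<open>fact k\<close> comes from that term; \<open>2 powr q\<close> converts
    between x and 1 + x, as 1 + x \<le> 2 for x \<le> 1 and (1 + x) / 2 \<le> x otherwise.\<close>
  define C where "C = fact k * 2 powr q"
  have fact: "(1::real) \<le> fact k" by (rule fact_ge_1)
  have "exp (- (x powr \<theta>)) \<le> C * (1 + x) powr (- q)" if x: "0 \<le> x" for x
  proof (cases "x \<le> 1")
    case True
    have "exp (- (x powr \<theta>)) \<le> 1 * 1" by simp
    also have "\<dots> \<le> fact k * (2 powr q * (1 + x) powr (- q))"
      using x True \<open>0 \<le> q\<close> fact
      by (intro mult_mono) (auto simp: powr_minus_divide divide_simps intro!: powr_mono2)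
    finally show ?thesis by (simp add: C_def)
  next
    case False
    have "(x powr \<theta>) ^ k / fact k \<le> exp (x powr \<theta>)"
      using sum_le_suminf[OF sums_summable[OF exp_converges], of "{k}" "x powr \<theta>"] exp_converges[of "x powr \<theta>"]
      by (simp add: sums_iff field_simps)
    then have "exp (- (x powr \<theta>)) \<le> fact k / (x powr \<theta>) ^ k"
      using False by (simp add: exp_minus field_simps)
    also have "(x powr \<theta>) ^ k = x powr (\<theta> * k)"
      using False by (simp add: powr_powr flip: powr_realpow)
    also have "fact k / x powr (\<theta> * k) \<le> fact k / x powr q"
      using False k by (intro divide_left_mono powr_mono) auto
    also have "\<dots> \<le> fact k / ((1 + x) / 2) powr q"
      using False \<open>0 \<le> q\<close> by (intro divide_left_mono powr_mono2) auto
    also have "\<dots> = C * (1 + x) powr (- q)"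
      using False by (simp add: C_def powr_divide powr_minus_divide)
    finally show ?thesis .
  qed
  moreover have "0 < C" using fact by (simp add: C_def)
  ultimately show ?thesis using that by blast
qed

text \<open>Above the dimension the estimate on balls is uniform in the radius, and monotone
  convergence along balls of integer radius reaches the whole space.\<close>

lemma integrable_weight:
  assumes "real DIM('a) < A"
  shows "integrable lborel (\<lambda>x::'a::euclidean_space. (1 + norm x) powr (- A))"
proof (rule integrableI_bounded)
  let ?w = "unit_ball_vol (real DIM('a))"
  let ?B = "ennreal ?w * (1 + ennreal A * ennreal (1 / (A - DIM('a))))"
  have A: "0 < A" using assms of_nat_0_le_iff[of "DIM('a)"] by linarith
  have "(\<integral>\<^sup>+x. ennreal (norm ((1 + norm (x::'a)) powr (- A))) \<partial>lborel) =
      (\<integral>\<^sup>+x. (SUP n. ennreal ((1 + norm x) powr (- A)) * indicator (ball 0 (real n)) (x::'a)) \<partial>lborel)"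
  proof (rule nn_integral_cong)
    fix x :: 'a
    show "ennreal (norm ((1 + norm x) powr (- A))) = (SUP n. ennreal ((1 + norm x) powr (- A)) * indicator (ball 0 (real n)) x)"
    proof (rule antisym)
      obtain n where "norm x < real n" using reals_Archimedean2 by blast
      then have "ennreal (norm ((1 + norm x) powr (- A))) \<le> ennreal ((1 + norm x) powr (- A)) * indicator (ball 0 (real n)) x"
        by simp
      also have "\<dots> \<le> (SUP n. ennreal ((1 + norm x) powr (- A)) * indicator (ball 0 (real n)) x)"
        by (rule SUP_upper) simp
      finally show "ennreal (norm ((1 + norm x) powr (- A))) \<le> (SUP n. ennreal ((1 + norm x) powr (- A)) * indicator (ball 0 (real n)) x)" .
      show "(SUP n. ennreal ((1 + norm x) powr (- A)) * indicator (ball 0 (real n)) x) \<le> ennreal (norm ((1 + norm x) powr (- A)))"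
        by (rule SUP_least) (auto simp: indicator_def)
    qed
  qed
  also have "\<dots> = (SUP n. \<integral>\<^sup>+x. ennreal ((1 + norm (x::'a)) powr (- A)) * indicator (ball 0 (real n)) x \<partial>lborel)"
    by (rule nn_integral_monotone_convergence_SUP)
       (auto simp: incseq_def le_fun_def indicator_def)
  also have "\<dots> \<le> ?B"
  proof (rule SUP_least)
    fix n :: nat
    have "(\<integral>\<^sup>+r. ennreal ((1 + r) powr (DIM('a) - A - 1)) * indicator {0..real n} r \<partial>lborel) =
        ennreal ((1 + real n) powr (DIM('a) - A) / (DIM('a) - A) - 1 / (DIM('a) - A))"
      using nn_integral_one_plus_powr[of 0 "real n" "DIM('a) - A"] assms by simp
    also have "\<dots> \<le> ennreal (1 / (A - DIM('a)))"
    proof (intro ennreal_leI)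
      have "x / (DIM('a) - A) = - (x / (A - DIM('a)))" for x
        by (metis minus_diff_eq minus_divide_right)
      then show "(1 + real n) powr (DIM('a) - A) / (DIM('a) - A) - 1 / (DIM('a) - A) \<le> 1 / (A - DIM('a))"
        using assms by simp
    qed
    finally have "(\<integral>\<^sup>+r. ennreal ((1 + r) powr (DIM('a) - A - 1)) * indicator {0..real n} r \<partial>lborel) \<le>
       ennreal (1 / (A - DIM('a)))" .
    moreover have "(1 + real n) powr (DIM('a) - A) \<le> 1"
      using assms powr_mono[of "DIM('a) - A" 0 "1 + real n"] by simp
    ultimately show "(\<integral>\<^sup>+x. ennreal ((1 + norm (x::'a)) powr (- A)) * indicator (ball 0 (real n)) x \<partial>lborel) \<le> ?B"
      by (intro order_trans[OF nn_integral_ball_weight_le[OF A]] mult_left_mono add_mono) auto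
  qed
  also have "?B < \<infinity>"
    by (auto simp: ennreal_mult_less_top)
  finally show "(\<integral>\<^sup>+x. ennreal (norm ((1 + norm (x::'a)) powr (- A))) \<partial>lborel) < \<infinity>" .
qed simp

text \<open>This is the symbol at time 1; its integrability is what allows Fourier inversion for the
  kernel.\<close>

lemma integrable_exp_neg_powr:
  assumes "0 < \<theta>"
  shows "integrable lborel (\<lambda>x::'a::euclidean_space. exp (- (norm x powr \<theta>)))"
proof -
  let ?q = "real DIM('a) + 1"
  obtain C where C: "0 < C" "\<And>x. 0 \<le> x \<Longrightarrow> exp (- (x powr \<theta>)) \<le> C * (1 + x) powr (- ?q)"
    using exp_neg_powr_le[OF assms, of ?q] by auto
  have "integrable lborel (\<lambda>x::'a. (1 + norm x) powr (- ?q))"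
    by (rule integrable_weight) simp
  then have "integrable lborel (\<lambda>x::'a. C * (1 + norm x) powr (- ?q))"
    by (rule integrable_mult_right)
  then show ?thesis
    by (rule Bochner_Integration.integrable_bound) (use C in auto)
qed

section \<open>The fractional heat kernel\<close>

locale fractional_heat_kernel =
  fixes \<theta> :: real and G :: "'a::euclidean_space \<Rightarrow> real \<Rightarrow> real"
  assumes \<theta>_pos: "0 < \<theta>" and G: "fundamental_solution \<theta> G"
begin

text \<open>By inversion this is the value of the kernel at x = 0, t = 1, its maximum at time 1; by
  scaling it becomes the constant in the sup bound for all t.\<close>

definition symbol_mass :: real where
  "symbol_mass = (\<integral>\<xi>. exp (- (norm (\<xi>::'a) powr \<theta>)) \<partial>lborel) / (2 * pi) ^ DIM('a)"

lemma G_pos: "0 < t \<Longrightarrow> 0 < G x t"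
  using G by (simp add: fundamental_solution_def)

lemma continuous_on_G: "continuous_on (UNIV \<times> {0<..}) (\<lambda>(x, t). G x t)"
proof -
  have "Ck_on 0 (\<lambda>(x, t). G x t) (UNIV \<times> {0<..})"
    using G unfolding fundamental_solution_def smooth_on_def by blast
  then show ?thesis by simp
qed

lemma continuous_on_G_space: "0 < t \<Longrightarrow> continuous_on UNIV (\<lambda>x. G x t)"
  using continuous_on_compose2[OF continuous_on_G, of UNIV "\<lambda>x. (x, t)"]
  by (simp add: continuous_on_Pair image_subset_iff)

text \<open>The values of \<open>G\<close> at times \<open>t \<le> 0\<close> are arbitrary; \<open>H\<close> cuts them off.\<close>
definition H :: "'a \<Rightarrow> real \<Rightarrow> ennreal" where
  "H x t = (if 0 < t then ennreal (G x t) else 0)"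

text \<open>Joint measurability in space and time is what the Tonelli exchanges rest on. G is known
  to be continuous on an open half space, and extension by 0 off that set stays Borel.\<close>

lemma measurable_H_pair: "case_prod H \<in> borel_measurable borel"
proof -
  have "(\<lambda>z. if z \<in> UNIV \<times> {0<..} then (\<lambda>(x, t). G x t) z else 0) \<in> borel_measurable borel"
    by (intro borel_measurable_continuous_on_if continuous_on_G)
       (auto intro!: borel_open open_Times)
  then have "(\<lambda>z. ennreal (if z \<in> UNIV \<times> {0<..} then (\<lambda>(x, t). G x t) z else 0)) \<in> borel_measurable borel"
    by simp
  also have "(\<lambda>z. ennreal (if z \<in> UNIV \<times> {0<..} then (\<lambda>(x, t). G x t) z else 0)) = case_prod H"
    by (auto simp: H_def fun_eq_iff)
  finally show ?thesis .
qed

lemma measurable_H [measurable]: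
  assumes [measurable]: "f \<in> borel_measurable M" "g \<in> borel_measurable M"
  shows "(\<lambda>x. H (f x) (g x)) \<in> borel_measurable M"
  using measurable_compose[OF borel_measurable_Pair measurable_H_pair, OF assms] by simp

lemma measurable_G_space [measurable]: "0 < t \<Longrightarrow> (\<lambda>x. G x t) \<in> borel_measurable borel"
  by (intro borel_measurable_continuous_onI continuous_on_G_space)

lemma integrable_G: "0 < t \<Longrightarrow> integrable lborel (\<lambda>x. G x t)"
  using G by (simp add: fundamental_solution_def integrable_completion)

lemma fourier_G:
  assumes "0 < t"
  shows "(\<integral>y. complex_of_real (G y t) * exp (- (\<i> * of_real (\<xi> \<bullet> y))) \<partial>lborel) = of_real (exp (- t * norm \<xi> powr \<theta>))"
proof -
  have [measurable]: "(\<lambda>x. G x t) \<in> borel_measurable borel" using assms by simp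
  have "(LINT y|lebesgue. complex_of_real (G y t) * exp (- (\<i> * of_real (\<xi> \<bullet> y)))) = of_real (exp (- t * norm \<xi> powr \<theta>))"
    using G assms unfolding fundamental_solution_def by blast
  then show ?thesis
    by (subst (asm) integral_completion) simp_all
qed

text \<open>The Fourier transform at frequency 0 is the total mass; a reflection brings it to
  convolution form.\<close>

lemma mass_G:
  assumes "0 < t"
  shows "(\<integral>\<^sup>+y. ennreal (G (x - y) t) \<partial>lborel) = 1"
proof -
  have [measurable]: "(\<lambda>x. G x t) \<in> borel_measurable borel" using assms by simp
  have "complex_of_real (\<integral>y. G y t \<partial>lborel) = 1"
    using fourier_G[OF assms, of 0] \<theta>_pos by simp
  then have "(\<integral>y. G y t \<partial>lborel) = 1"
    using of_real_eq_1_iff by blast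
  then have "(\<integral>\<^sup>+y. ennreal (G y t) \<partial>lborel) = 1"
    using nn_integral_eq_integral[OF integrable_G[OF assms]] G_pos[OF assms] by (simp add: less_imp_le)
  then show ?thesis
    by (subst (asm) nn_integral_lborel_affine[of _ "-1" x]) simp_all
qed

text \<open>Dilating \<xi> by \<open>t powr (1 / \<theta>)\<close> turns the symbol at time 1 into
  the symbol at time t, and the Jacobian produces the decay rate N/\<theta>.\<close>

lemma integrable_symbol:
  assumes "0 < t"
  shows "integrable lborel (\<lambda>\<xi>::'a. exp (- t * norm \<xi> powr \<theta>))"
    and "(\<integral>\<xi>. exp (- t * norm (\<xi>::'a) powr \<theta>) \<partial>lborel) = (2 * pi) ^ DIM('a) * symbol_mass * t powr (- DIM('a) / \<theta>)"
proof -
  let ?c = "t powr (1 / \<theta>)"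
  have c: "0 < ?c" using assms by simp
  have *: "exp (- (norm (0 + ?c *\<^sub>R \<xi>) powr \<theta>)) = exp (- t * norm \<xi> powr \<theta>)" for \<xi> :: 'a
    using assms \<theta>_pos by (simp add: powr_mult powr_powr)
  have int: "integrable lborel (\<lambda>\<xi>::'a. exp (- (norm \<xi> powr \<theta>)))"
    by (rule integrable_exp_neg_powr[OF \<theta>_pos])
  show "integrable lborel (\<lambda>\<xi>::'a. exp (- t * norm \<xi> powr \<theta>))"
    using integrable_lborel_affine[OF int, of ?c 0] c unfolding * by simp
  have "(\<integral>\<xi>. exp (- (norm (\<xi>::'a) powr \<theta>)) \<partial>lborel) = ?c ^ DIM('a) * (\<integral>\<xi>. exp (- t * norm (\<xi>::'a) powr \<theta>) \<partial>lborel)"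
    using integral_lborel_affine[of "\<lambda>\<xi>::'a. exp (- (norm \<xi> powr \<theta>))" ?c 0] c unfolding * by simp
  moreover have "?c ^ DIM('a) * t powr (- DIM('a) / \<theta>) = 1"
    using assms by (simp add: powr_powr flip: powr_realpow powr_add)
  ultimately show "(\<integral>\<xi>. exp (- t * norm (\<xi>::'a) powr \<theta>) \<partial>lborel) = (2 * pi) ^ DIM('a) * symbol_mass * t powr (- DIM('a) / \<theta>)"
    unfolding symbol_mass_def by (simp add: mult_ac)
qed

lemma symbol_mass_nonneg: "0 \<le> symbol_mass"
  unfolding symbol_mass_def by simp

lemma G_le:
  assumes "0 < t"
  shows "G x t \<le> symbol_mass * t powr (- DIM('a) / \<theta>)"
proof -
  have "(2 * pi) ^ DIM('a) * G x t \<le> (\<integral>\<xi>. \<bar>exp (- t * norm (\<xi>::'a) powr \<theta>)\<bar> \<partial>lborel)"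
    by (rule fourier_inversion(2)[OF integrable_G[OF assms] continuous_on_G_space[OF assms] _ integrable_symbol(1)[OF assms] fourier_G[OF assms]])
       (simp add: G_pos[OF assms] less_imp_le)
  then show ?thesis
    using integrable_symbol(2)[OF assms] by (simp add: mult.assoc)
qed

lemma G_inversion:
  assumes "0 < t"
  shows "(\<integral>\<xi>. of_real (exp (- t * norm \<xi> powr \<theta>)) * iexp (\<xi> \<bullet> x) \<partial>lborel) = complex_of_real ((2 * pi) ^ DIM('a) * G x t)"
  by (rule fourier_inversion(1)[OF integrable_G[OF assms] continuous_on_G_space[OF assms] _ integrable_symbol(1)[OF assms] fourier_G[OF assms], symmetric])
     (simp add: G_pos[OF assms] less_imp_le)

text \<open>On the frequency side this is multiplicativity of exponentials. In the inversion formula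
  at time a + b, the factor belonging to b is read as the transform of G(., b), the multiplication
  formula moves it to the space side, and inversion at time a recovers the other kernel.\<close>

lemma G_semigroup:
  assumes a: "0 < a" and b: "0 < b"
  shows "(\<integral>\<^sup>+y. ennreal (G (x - y) a) * ennreal (G (y - z) b) \<partial>lborel) = ennreal (G (x - z) (a + b))"
proof -
  have [measurable]: "(\<lambda>x. G x a) \<in> borel_measurable borel" "(\<lambda>x. G x b) \<in> borel_measurable borel"
    using assms by simp_all
  let ?P = "(2 * pi) ^ DIM('a)"
  have conv: "(\<integral>y. G y b * G (x - y) a \<partial>lborel) = G x (a + b)" for x
  proof -
    have "complex_of_real (?P * G x (a + b)) =
        (\<integral>\<xi>. of_real (exp (- b * norm \<xi> powr \<theta>)) * (of_real (exp (- a * norm \<xi> powr \<theta>)) * iexp (\<xi> \<bullet> x)) \<partial>lborel)"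
      unfolding G_inversion[OF add_pos_pos[OF a b], symmetric]
      by (intro Bochner_Integration.integral_cong) (auto simp: algebra_simps simp flip: exp_add exp_of_real of_real_mult)
    also have "\<dots> = (\<integral>y. complex_of_real (G y b) * of_real (?P * G (x - y) a) \<partial>lborel)"
      unfolding fourier_G[OF b, symmetric] fourier_integral_swap[OF integrable_G[OF b] integrable_symbol(1)[OF a]] G_inversion[OF a] ..
    also have "\<dots> = of_real (\<integral>y. ?P * (G y b * G (x - y) a) \<partial>lborel)"
      by (simp add: mult_ac flip: integral_complex_of_real of_real_mult)
    also have "(\<integral>y. ?P * (G y b * G (x - y) a) \<partial>lborel) = ?P * (\<integral>y. G y b * G (x - y) a \<partial>lborel)"
      by (rule integral_mult_right_zero)
    finally have "?P * G x (a + b) = ?P * (\<integral>y. G y b * G (x - y) a \<partial>lborel)"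
      using of_real_eq_iff by blast
    then show ?thesis by simp
  qed
  \<comment> \<open>One kernel is bounded and the other integrable; this allows the passage from the
    Bochner integral to the nonnegative integral.\<close>
  have int: "integrable lborel (\<lambda>y. G y b * G (x - y) a)" for x
  proof (rule Bochner_Integration.integrable_bound)
    show "integrable lborel (\<lambda>y. G y b * (symbol_mass * a powr (- DIM('a) / \<theta>)))"
      by (intro integrable_mult_left integrable_G b)
    have "G y b * G (x - y) a \<le> G y b * (symbol_mass * a powr (- DIM('a) / \<theta>))" for y
      by (intro mult_left_mono G_le a less_imp_le[OF G_pos[OF b]])
    then show "AE y in lborel. norm (G y b * G (x - y) a) \<le> norm (G y b * (symbol_mass * a powr (- DIM('a) / \<theta>)))"
      using symbol_mass_nonneg G_pos[OF a] G_pos[OF b] by (intro AE_I2) (auto simp: abs_mult less_imp_le)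
  qed simp
  have "(\<integral>\<^sup>+y. ennreal (G (x - y) a) * ennreal (G (y - z) b) \<partial>lborel) =
      (\<integral>\<^sup>+y. ennreal (G (x - z - y) a) * ennreal (G y b) \<partial>lborel)"
    by (subst nn_integral_lborel_affine[of _ 1 z]) (simp_all add: algebra_simps)
  also have "\<dots> = (\<integral>\<^sup>+y. ennreal (G y b * G (x - z - y) a) \<partial>lborel)"
    using G_pos[OF a] G_pos[OF b] by (intro nn_integral_cong) (auto simp: mult.commute less_imp_le simp flip: ennreal_mult)
  also have "\<dots> = ennreal (G (x - z) (a + b))"
    using G_pos[OF a] G_pos[OF b] conv by (subst nn_integral_eq_integral[OF int]) (auto simp: less_imp_le)
  finally show ?thesis .
qed

end

section \<open>Picard iteration and the existence criterion\<close>

lemma ennreal_powr_ennreal: "0 \<le> r \<Longrightarrow> ennreal_powr (ennreal r) p = ennreal (r powr p)"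
  by (simp add: ennreal_powr_def)

lemma ennreal_powr_mono:
  assumes "0 < p" "a \<le> b"
  shows "ennreal_powr a p \<le> ennreal_powr b p"
proof (cases "b = top")
  case False
  then have "a \<noteq> top" using assms top.extremum_unique by auto
  with False assms show ?thesis
    by (auto simp: ennreal_powr_def less_top intro!: ennreal_leI powr_mono2 enn2real_mono)
qed (simp add: ennreal_powr_def)

lemma ennreal_powr_inverse:
  assumes "0 < p"
  shows "ennreal_powr (ennreal_powr a p) (1 / p) = a"
  using assms by (cases a) (auto simp: ennreal_powr_def powr_powr)

text \<open>The power map is an order isomorphism of [0, \<infinity>] with inverse exponent 1/p,
  hence commutes with suprema.\<close>

lemma ennreal_powr_SUP:
  fixes f :: "nat \<Rightarrow> ennreal"
  assumes "0 < p"
  shows "ennreal_powr (SUP n. f n) p = (SUP n. ennreal_powr (f n) p)"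
proof (rule antisym)
  let ?S = "SUP n. ennreal_powr (f n) p"
  have "ennreal_powr (f n) p \<le> ?S" for n
    by (rule SUP_upper) simp
  then have "f n \<le> ennreal_powr ?S (1 / p)" for n
    using ennreal_powr_mono[of "1 / p" "ennreal_powr (f n) p" ?S] assms
    by (simp add: ennreal_powr_inverse)
  then have "(SUP n. f n) \<le> ennreal_powr ?S (1 / p)"
    by (rule SUP_least)
  then have "ennreal_powr (SUP n. f n) p \<le> ennreal_powr (ennreal_powr ?S (1 / p)) p"
    using assms by (intro ennreal_powr_mono)
  then show "ennreal_powr (SUP n. f n) p \<le> ?S"
    using ennreal_powr_inverse[of "1 / p" ?S] assms by simp
qed (use assms in \<open>auto intro!: SUP_least ennreal_powr_mono SUP_upper\<close>)

lemma measurable_ennreal_powr [measurable]: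
  assumes [measurable]: "f \<in> borel_measurable M"
  shows "(\<lambda>x. ennreal_powr (f x) p) \<in> borel_measurable M"
  unfolding ennreal_powr_def by measurable

text \<open>Solutions are controlled almost everywhere in (x, t), whereas the Duhamel term
  integrates over space inside time; this provides the slices in that order.\<close>

lemma AE_lborel_swap:
  fixes P :: "'a::euclidean_space \<times> 'b::euclidean_space \<Rightarrow> bool"
  assumes "AE z in lborel. P z"
  shows "AE s in lborel. AE y in lborel. P (y, s)"
proof -
  have "AE z in distr (lborel \<Otimes>\<^sub>M lborel) (lborel \<Otimes>\<^sub>M lborel) (\<lambda>(s, y). (y, s)). P z"
    using assms unfolding lborel_prod[symmetric] by (subst (asm) lborel_pair.distr_pair_swap)
  then have "AE z in lborel \<Otimes>\<^sub>M lborel. P (case z of (s, y) \<Rightarrow> (y, s))"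
    by (rule AE_distrD[rotated]) simp
  then show ?thesis
    using lborel_pair.AE_pair by fastforce
qed

section \<open>The Duhamel map and its iterates\<close>

context fractional_heat_kernel
begin

text \<open>\<open>ennreal\<close> truncates negative values of f to 0, so a Borel representative of
  the datum can be inserted without correcting its sign on a null set.\<close>

definition heat :: "('a \<Rightarrow> real) \<Rightarrow> 'a \<Rightarrow> real \<Rightarrow> ennreal" where
  "heat f x t = (\<integral>\<^sup>+y. H (x - y) t * ennreal (f y) \<partial>lborel)"

text \<open>The upper limit s < t is built into \<open>H\<close>, which vanishes at nonpositive
  times; the domain of integration is then the same for all t, which simplifies
  measurability.\<close>

definition duhamel :: "real \<Rightarrow> ('a \<Rightarrow> real) \<Rightarrow> ('a \<Rightarrow> real \<Rightarrow> ennreal) \<Rightarrow> 'a \<Rightarrow> real \<Rightarrow> ennreal" where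
  "duhamel p f w x t = heat f x t +
     (\<integral>\<^sup>+s. (\<integral>\<^sup>+y. H (x - y) (t - s) * ennreal_powr (w y s) p \<partial>lborel) * indicator {0<..} s \<partial>lborel)"

text \<open>Starting from 0 makes the sequence increasing and puts its first member below every
  solution.\<close>

primrec picard :: "real \<Rightarrow> ('a \<Rightarrow> real) \<Rightarrow> nat \<Rightarrow> 'a \<Rightarrow> real \<Rightarrow> ennreal" where
  "picard p f 0 = (\<lambda>x t. 0)"
| "picard p f (Suc n) = duhamel p f (picard p f n)"

lemma measurable_heat:
  assumes [measurable]: "f \<in> borel_measurable borel"
  shows "case_prod (heat f) \<in> borel_measurable (borel \<Otimes>\<^sub>M borel)"
  unfolding heat_def by measurable

lemma measurable_duhamel:
  assumes [measurable]: "f \<in> borel_measurable borel"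
    and [measurable]: "case_prod w \<in> borel_measurable (borel \<Otimes>\<^sub>M borel)"
  shows "case_prod (duhamel p f w) \<in> borel_measurable (borel \<Otimes>\<^sub>M borel)"
proof -
  note [measurable] = measurable_heat[OF assms(1)]
  show ?thesis unfolding duhamel_def by measurable
qed

lemma measurable_picard:
  assumes "f \<in> borel_measurable borel"
  shows "case_prod (picard p f n) \<in> borel_measurable (borel \<Otimes>\<^sub>M borel)"
  by (induction n) (auto intro!: measurable_duhamel assms)

lemma duhamel_mono:
  assumes "0 < p" "\<And>y s. 0 < s \<Longrightarrow> s < t \<Longrightarrow> w y s \<le> w' y s"
  shows "duhamel p f w x t \<le> duhamel p f w' x t"
  unfolding duhamel_def
proof (intro add_left_mono nn_integral_mono)
  fix s :: real
  show "(\<integral>\<^sup>+y. H (x - y) (t - s) * ennreal_powr (w y s) p \<partial>lborel) * indicator {0<..} s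
    \<le> (\<integral>\<^sup>+y. H (x - y) (t - s) * ennreal_powr (w' y s) p \<partial>lborel) * indicator {0<..} s"
  proof (cases "0 < s \<and> s < t")
    case True
    then have "(\<integral>\<^sup>+y. H (x - y) (t - s) * ennreal_powr (w y s) p \<partial>lborel) \<le>
        (\<integral>\<^sup>+y. H (x - y) (t - s) * ennreal_powr (w' y s) p \<partial>lborel)"
      by (intro nn_integral_mono mult_left_mono ennreal_powr_mono assms) auto
    then show ?thesis by (rule mult_right_mono) simp
  qed (auto simp: H_def)
qed

lemma picard_mono:
  assumes "0 < p"
  shows "picard p f n x t \<le> picard p f (Suc n) x t"
proof (induction n arbitrary: x t)
  case (Suc n)
  then show ?case
    using assms by (auto intro!: duhamel_mono)
qed simp

lemma incseq_picard:
  assumes "0 < p"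
  shows "incseq (\<lambda>n. picard p f n x t)"
  using picard_mono[OF assms] by (rule incseq_SucI)

text \<open>Monotone convergence in y and then in s, together with continuity of the power along
  increasing sequences. The identity holds at every point, even where the limit is infinite;
  finiteness is a separate matter.\<close>

lemma duhamel_SUP_picard:
  assumes f: "f \<in> borel_measurable borel" and p: "0 < p"
  shows "duhamel p f (\<lambda>x t. SUP n. picard p f n x t) x t = (SUP n. picard p f n x t)"
proof -
  note [measurable] = measurable_picard[OF f]
  let ?I = "\<lambda>n s. \<integral>\<^sup>+y. H (x - y) (t - s) * ennreal_powr (picard p f n y s) p \<partial>lborel"
  have mono: "picard p f i y s \<le> picard p f j y s" if "i \<le> j" for i j y s
    using incseq_picard[OF p] that by (auto simp: incseq_def)
  have "(\<integral>\<^sup>+y. H (x - y) (t - s) * ennreal_powr (SUP n. picard p f n y s) p \<partial>lborel) = (SUP n. ?I n s)" for s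
    unfolding ennreal_powr_SUP[OF p] SUP_mult_left_ennreal
    by (rule nn_integral_monotone_convergence_SUP)
       (auto simp: incseq_def le_fun_def intro!: mult_left_mono ennreal_powr_mono p mono)
  then have "(\<integral>\<^sup>+s. (\<integral>\<^sup>+y. H (x - y) (t - s) * ennreal_powr (SUP n. picard p f n y s) p \<partial>lborel) * indicator {0<..} s \<partial>lborel) =
      (\<integral>\<^sup>+s. (SUP n. ?I n s * indicator {0<..} s) \<partial>lborel)"
    by (simp add: SUP_mult_right_ennreal)
  also have "\<dots> = (SUP n. \<integral>\<^sup>+s. ?I n s * indicator {0<..} s \<partial>lborel)"
    by (rule nn_integral_monotone_convergence_SUP)
       (auto simp: incseq_def le_fun_def intro!: mult_right_mono nn_integral_mono mult_left_mono ennreal_powr_mono p mono)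
  finally have "duhamel p f (\<lambda>x t. SUP n. picard p f n x t) x t = (SUP n. picard p f (Suc n) x t)"
    by (simp add: duhamel_def ennreal_SUP_add_right)
  also have "\<dots> = (SUP n. picard p f n x t)"
    using picard_mono[OF p, of f _ x t] by (intro antisym SUP_mono) blast+
  finally show ?thesis .
qed

text \<open>The right-hand side does not depend on s, so the linear flow can be pulled out of the
  time integral in the Duhamel term.\<close>

lemma heat_semigroup:
  assumes [measurable]: "f \<in> borel_measurable borel" and "0 < s" "s < t"
  shows "(\<integral>\<^sup>+y. H (x - y) (t - s) * heat f y s \<partial>lborel) = heat f x t"
proof -
  have "(\<integral>\<^sup>+y. H (x - y) (t - s) * heat f y s \<partial>lborel) =
      (\<integral>\<^sup>+y. \<integral>\<^sup>+z. H (x - y) (t - s) * (H (y - z) s * ennreal (f z)) \<partial>lborel \<partial>lborel)"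
    unfolding heat_def by (simp add: nn_integral_cmult)
  also have "\<dots> = (\<integral>\<^sup>+z. \<integral>\<^sup>+y. H (x - y) (t - s) * (H (y - z) s * ennreal (f z)) \<partial>lborel \<partial>lborel)"
    by (rule lborel_pair.Fubini') measurable
  also have "\<dots> = (\<integral>\<^sup>+z. H (x - z) t * ennreal (f z) \<partial>lborel)"
  proof (intro nn_integral_cong)
    fix z
    have "(\<integral>\<^sup>+y. H (x - y) (t - s) * (H (y - z) s * ennreal (f z)) \<partial>lborel) =
        (\<integral>\<^sup>+y. H (x - y) (t - s) * H (y - z) s \<partial>lborel) * ennreal (f z)"
      by (subst nn_integral_multc[symmetric]) (auto simp: mult.assoc)
    also have "(\<integral>\<^sup>+y. H (x - y) (t - s) * H (y - z) s \<partial>lborel) = H (x - z) t"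
      using G_semigroup[of "t - s" s x z] assms(2,3) by (simp add: H_def)
    finally show "(\<integral>\<^sup>+y. H (x - y) (t - s) * (H (y - z) s * ennreal (f z)) \<partial>lborel) = H (x - z) t * ennreal (f z)" .
  qed
  finally show ?thesis unfolding heat_def .
qed

text \<open>The function \<open>b\<close> stands for the spatial supremum of the linear flow. A
  measurable majorant serves the same purpose and avoids the measurability of a supremum over
  uncountably many points.\<close>

lemma picard_le_heat:
  fixes b :: "real \<Rightarrow> real"
  assumes f: "f \<in> borel_measurable borel" and p: "1 < p"
    and b: "\<And>s. 0 < s \<Longrightarrow> s < T \<Longrightarrow> 0 \<le> b s" and [measurable]: "b \<in> borel_measurable borel"
    and heat_le: "\<And>x s. 0 < s \<Longrightarrow> s < T \<Longrightarrow> heat f x s \<le> ennreal (b s)"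
    and int: "(\<integral>\<^sup>+s. ennreal (2 powr p * b s powr (p - 1)) * indicator {0<..<T} s \<partial>lborel) \<le> 1"
    and t: "0 < t" "t < T"
  shows "picard p f n x t \<le> 2 * heat f x t"
  using t
proof (induction n arbitrary: x t)
  case (Suc n)
  \<comment> \<open>Of the p factors one remains a copy of the linear flow, to be propagated by the
    semigroup; the other p - 1 are replaced by their bound \<open>b s\<close>.\<close>
  have key: "ennreal_powr (picard p f n y s) p \<le> ennreal (2 powr p * b s powr (p - 1)) * heat f y s"
    if s: "0 < s" "s < t" for y s
  proof -
    have sT: "s < T" using s Suc.prems by simp
    have "heat f y s \<noteq> top"
      using heat_le[OF s(1) sT, of y] by (auto simp: top_unique)
    then obtain r where r: "heat f y s = ennreal r" "0 \<le> r"
      by (cases "heat f y s") auto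
    have rb: "r \<le> b s"
      using heat_le[OF s(1) sT, of y] b[OF s(1) sT] r by simp
    have "ennreal_powr (picard p f n y s) p \<le> ennreal_powr (2 * heat f y s) p"
      using p s sT by (intro ennreal_powr_mono Suc.IH) auto
    also have "2 * heat f y s = ennreal (2 * r)"
      using r by (simp add: ennreal_mult)
    also have "ennreal_powr (ennreal (2 * r)) p = ennreal ((2 * r) powr p)"
      using r by (simp add: ennreal_powr_ennreal)
    also have "(2 * r) powr p = 2 powr p * (r powr (p - 1) * r)"
      using r p by (cases "r = 0") (auto simp: powr_mult powr_diff)
    also have "\<dots> \<le> 2 powr p * (b s powr (p - 1) * r)"
      using r p rb by (intro mult_left_mono mult_right_mono powr_mono2) auto
    also have "ennreal (2 powr p * (b s powr (p - 1) * r)) = ennreal (2 powr p * b s powr (p - 1)) * heat f y s"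
      using r by (simp add: ennreal_mult mult.assoc)
    finally show ?thesis by (simp add: ennreal_leI)
  qed
  note [measurable] = measurable_heat[OF f]
  have "(\<integral>\<^sup>+s. (\<integral>\<^sup>+y. H (x - y) (t - s) * ennreal_powr (picard p f n y s) p \<partial>lborel) * indicator {0<..} s \<partial>lborel) \<le>
      (\<integral>\<^sup>+s. (ennreal (2 powr p * b s powr (p - 1)) * indicator {0<..<T} s) * heat f x t \<partial>lborel)"
  proof (intro nn_integral_mono)
    fix s :: real
    show "(\<integral>\<^sup>+y. H (x - y) (t - s) * ennreal_powr (picard p f n y s) p \<partial>lborel) * indicator {0<..} s \<le>
        (ennreal (2 powr p * b s powr (p - 1)) * indicator {0<..<T} s) * heat f x t"
    proof (cases "0 < s \<and> s < t")
      case True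
      then have s: "0 < s" "s < t" by auto
      have "(\<integral>\<^sup>+y. H (x - y) (t - s) * ennreal_powr (picard p f n y s) p \<partial>lborel) \<le>
          (\<integral>\<^sup>+y. ennreal (2 powr p * b s powr (p - 1)) * (H (x - y) (t - s) * heat f y s) \<partial>lborel)"
        using mult_left_mono[OF key[OF s], of "H (x - _) (t - s)"]
        by (intro nn_integral_mono) (simp add: mult.left_commute)
      also have "\<dots> = ennreal (2 powr p * b s powr (p - 1)) * heat f x t"
        by (subst nn_integral_cmult) (simp_all add: heat_semigroup[OF f s])
      finally show ?thesis using s Suc.prems by simp
    qed (auto simp: H_def)
  qed
  also have "\<dots> = (\<integral>\<^sup>+s. ennreal (2 powr p * b s powr (p - 1)) * indicator {0<..<T} s \<partial>lborel) * heat f x t"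
    by (rule nn_integral_multc) measurable
  \<comment> \<open>The Duhamel term is at most one copy of the linear flow; together with the free
    term this makes the 2 of the claim.\<close>
  also have "\<dots> \<le> 1 * heat f x t"
    by (intro mult_right_mono int) simp
  finally show ?case
    by (simp add: duhamel_def mult_2 add_left_mono)
qed simp

text \<open>The limit satisfies the equation at every point of the strip. Minimality follows because
  each iterate lies below any competing solution almost everywhere, and only countably many null
  sets are involved. The datum \<open>g\<close> is Lebesgue measurable, and \<open>f\<close> is a
  Borel representative of it.\<close>

lemma is_minimal_solution_picard:
  fixes b :: "real \<Rightarrow> real"
  assumes f: "f \<in> borel_measurable borel" and p: "1 < p"
    and g: "g \<in> borel_measurable lebesgue" and fg: "AE x in lebesgue. g x = f x"
    and b: "\<And>s. 0 < s \<Longrightarrow> s < T \<Longrightarrow> 0 \<le> b s" and b_meas: "b \<in> borel_measurable borel"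
    and heat_le: "\<And>x s. 0 < s \<Longrightarrow> s < T \<Longrightarrow> heat f x s \<le> ennreal (b s)"
    and int: "(\<integral>\<^sup>+s. ennreal (2 powr p * b s powr (p - 1)) * indicator {0<..<T} s \<partial>lborel) \<le> 1"
  shows "is_minimal_solution p G (function_measure g) (ennreal T) (\<lambda>x t. SUP n. picard p f n x t)"
proof -
  let ?u = "\<lambda>x t. SUP n. picard p f n x t"
  let ?rhs = "\<lambda>w x t. (\<integral>\<^sup>+y. ennreal (G (x - y) t) \<partial>function_measure g)
          + (\<integral>\<^sup>+s\<in>{0<..<t}. (\<integral>\<^sup>+y. ennreal (G (x - y) (t - s)) * ennreal_powr (w y s) p \<partial>lebesgue) \<partial>lebesgue)"
  have p0: "0 < p" using p by simp
  have strip: "(x, t) \<in> strip (ennreal T) \<longleftrightarrow> 0 < t \<and> t < T" for x :: 'a and t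
    by (auto simp: strip_def ennreal_less_iff)
  \<comment> \<open>\<open>nn_integral_completion\<close> holds for arbitrary integrands, so this
    identity also covers a competing solution, which is merely Lebesgue measurable on the
    strip.\<close>
  have rhs: "?rhs w x t = duhamel p f w x t" if t: "0 < t" for w x t
  proof -
    have [measurable]: "(\<lambda>y. G y t) \<in> borel_measurable borel" using t by simp
    have Gm: "(\<lambda>y. ennreal (G (x - y) t)) \<in> borel_measurable lebesgue"
      by (rule measurable_completion) measurable
    have "(\<integral>\<^sup>+y. ennreal (G (x - y) t) \<partial>function_measure g) = (\<integral>\<^sup>+y. ennreal (g y) * ennreal (G (x - y) t) \<partial>lebesgue)"
      unfolding function_measure_def using g Gm by (intro nn_integral_density) auto
    also have "\<dots> = (\<integral>\<^sup>+y. H (x - y) t * ennreal (f y) \<partial>lebesgue)"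
      using fg t by (intro nn_integral_cong_AE) (auto simp: H_def mult.commute)
    also have "\<dots> = heat f x t"
      by (simp add: heat_def nn_integral_completion)
    finally have 1: "(\<integral>\<^sup>+y. ennreal (G (x - y) t) \<partial>function_measure g) = heat f x t" .
    have 2: "(\<integral>\<^sup>+s\<in>{0<..<t}. (\<integral>\<^sup>+y. ennreal (G (x - y) (t - s)) * ennreal_powr (w y s) p \<partial>lebesgue) \<partial>lebesgue) =
        (\<integral>\<^sup>+s. (\<integral>\<^sup>+y. H (x - y) (t - s) * ennreal_powr (w y s) p \<partial>lborel) * indicator {0<..} s \<partial>lborel)"
      unfolding nn_integral_completion
    proof (rule nn_integral_cong)
      fix s :: real
      show "(\<integral>\<^sup>+y. ennreal (G (x - y) (t - s)) * ennreal_powr (w y s) p \<partial>lborel) * indicator {0<..<t} s =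
         (\<integral>\<^sup>+y. H (x - y) (t - s) * ennreal_powr (w y s) p \<partial>lborel) * indicator {0<..} s"
        by (cases "s < t") (auto simp: H_def indicator_def)
    qed
    show ?thesis unfolding 1 2 duhamel_def ..
  qed
  note [measurable] = measurable_picard[OF f]
  have "case_prod ?u \<in> borel_measurable (borel \<Otimes>\<^sub>M borel)"
    by measurable
  then have meas: "case_prod ?u \<in> borel_measurable (lebesgue_on (strip (ennreal T)))"
    unfolding borel_prod by (intro measurable_restrict_space1 measurable_completion) simp
  have finite: "?u x t < \<infinity>" if "0 < t" "t < T" for x t
  proof -
    have "?u x t \<le> 2 * heat f x t"
      by (intro SUP_least picard_le_heat[where b = b and T = T] assms that)
    also have "\<dots> \<le> 2 * ennreal (b t)"
      by (intro mult_left_mono heat_le that) simp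
    also have "\<dots> < \<infinity>" by (simp add: ennreal_mult_less_top)
    finally show ?thesis .
  qed
  have sol: "is_solution p G (function_measure g) (ennreal T) ?u"
    unfolding is_solution_def using meas finite
    by (auto simp: strip rhs duhamel_SUP_picard[OF f p0])
  moreover have "AE (x, t) in lebesgue. (x, t) \<in> strip (ennreal T) \<longrightarrow> ?u x t \<le> v x t"
    if v: "is_solution p G (function_measure g) (ennreal T) v" for v
  proof -
    have eq: "AE z in lborel. z \<in> strip (ennreal T) \<longrightarrow> v (fst z) (snd z) = duhamel p f v (fst z) (snd z)"
    proof -
      have "AE (x, t) in lborel. (x, t) \<in> strip (ennreal T) \<longrightarrow> v x t < \<infinity> \<and> v x t = ?rhs v x t"
        using v unfolding is_solution_def AE_completion_iff by blast
      then show ?thesis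
        by eventually_elim (auto simp: strip rhs)
    qed
    have "AE z in lborel. z \<in> strip (ennreal T) \<longrightarrow> picard p f n (fst z) (snd z) \<le> v (fst z) (snd z)" for n
    proof (induction n)
      case (Suc n)
      from AE_lborel_swap[OF Suc]
      have ae: "AE s in lborel. AE y in lborel. 0 < s \<and> s < T \<longrightarrow> picard p f n y s \<le> v y s"
        by (simp add: strip)
      \<comment> \<open>An almost everywhere bound on the previous iterate yields a bound at every
        point for the next one, because it enters only through integrals.\<close>
      have le: "picard p f (Suc n) x t \<le> duhamel p f v x t" if t: "0 < t" "t < T" for x t
      proof -
        have "(\<integral>\<^sup>+s. (\<integral>\<^sup>+y. H (x - y) (t - s) * ennreal_powr (picard p f n y s) p \<partial>lborel) * indicator {0<..} s \<partial>lborel) \<le>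
            (\<integral>\<^sup>+s. (\<integral>\<^sup>+y. H (x - y) (t - s) * ennreal_powr (v y s) p \<partial>lborel) * indicator {0<..} s \<partial>lborel)"
          using ae
        proof (intro nn_integral_mono_AE, eventually_elim)
          case (elim s)
          show ?case
          proof (cases "0 < s \<and> s < t")
            case True
            with elim t have "AE y in lborel. picard p f n y s \<le> v y s" by auto
            then have "(\<integral>\<^sup>+y. H (x - y) (t - s) * ennreal_powr (picard p f n y s) p \<partial>lborel) \<le>
                (\<integral>\<^sup>+y. H (x - y) (t - s) * ennreal_powr (v y s) p \<partial>lborel)"
              by (intro nn_integral_mono_AE, eventually_elim) (auto intro!: mult_left_mono ennreal_powr_mono p0)
            then show ?thesis by (rule mult_right_mono) simp
          qed (auto simp: H_def)
        qed
        then show ?thesis by (simp add: duhamel_def add_left_mono)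
      qed
      from eq show ?case
        by eventually_elim (use le in \<open>auto simp: strip\<close>)
    qed simp
    then have "AE z in lborel. \<forall>n. z \<in> strip (ennreal T) \<longrightarrow> picard p f n (fst z) (snd z) \<le> v (fst z) (snd z)"
      unfolding AE_all_countable by blast
    then have "AE z in lborel. case z of (x, t) \<Rightarrow> (x, t) \<in> strip (ennreal T) \<longrightarrow> ?u x t \<le> v x t"
      by eventually_elim (auto intro!: SUP_least)
    then show ?thesis by (rule AE_completion)
  qed
  ultimately show ?thesis
    unfolding is_minimal_solution_def by blast
qed

lemma max_existence_time_ge:
  fixes b :: "real \<Rightarrow> real"
  assumes "f \<in> borel_measurable borel" "1 < p"
    and "g \<in> borel_measurable lebesgue" "AE x in lebesgue. g x = f x"
    and "\<And>s. 0 < s \<Longrightarrow> s < T \<Longrightarrow> 0 \<le> b s" "b \<in> borel_measurable borel"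
    and "\<And>x s. 0 < s \<Longrightarrow> s < T \<Longrightarrow> heat f x s \<le> ennreal (b s)"
    and "(\<integral>\<^sup>+s. ennreal (2 powr p * b s powr (p - 1)) * indicator {0<..<T} s \<partial>lborel) \<le> 1"
    and "0 < T"
  shows "ennreal T \<le> max_existence_time p G (function_measure g)"
  unfolding max_existence_time_def
  using is_minimal_solution_picard[OF assms(1-8)] \<open>0 < T\<close> by (intro Sup_upper) auto

end

section \<open>Decay of the linear solution\<close>

text \<open>The logarithm is the integral of (1 + r)^(-1), met exactly when A = N. The summand 1
  keeps the factor at least 1, so that constants can be absorbed into it.\<close>

definition log_corr :: "real \<Rightarrow> real \<Rightarrow> real \<Rightarrow> real" where
  "log_corr A n r = (if A = n then 1 + ln (1 + r) else 1)"

lemma log_corr_ge_1: "0 \<le> r \<Longrightarrow> 1 \<le> log_corr A n r"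
  by (simp add: log_corr_def)

lemma log_corr_mono: "0 \<le> r \<Longrightarrow> r \<le> s \<Longrightarrow> log_corr A n r \<le> log_corr A n s"
  by (simp add: log_corr_def)

text \<open>The radial integral of (1 + r)^(N-A-1) has three regimes: power growth for A < N, a
  logarithm for A = N, boundedness for A > N. The exponent N - min A N together with
  \<open>log_corr\<close> describes all of them.\<close>

lemma nn_integral_ball_weight_bound:
  fixes A :: real
  assumes A: "0 < A"
  obtains C where "0 < C" "\<And>R. 0 \<le> R \<Longrightarrow>
    (\<integral>\<^sup>+y. ennreal ((1 + norm (y::'a::euclidean_space)) powr (- A)) * indicator (ball 0 R) y \<partial>lborel)
      \<le> ennreal (C * log_corr A DIM('a) R * (1 + R) powr (DIM('a) - min A DIM('a)))"
proof -
  let ?n = "real DIM('a)" and ?w = "unit_ball_vol (real DIM('a))"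
  have w: "0 < ?w" by simp
  \<comment> \<open>For A \<noteq> N the primitive contributes A / |N - A|, which blows up at A = N;
    there the logarithm takes over with coefficient N.\<close>
  define D where "D = (if A = ?n then 1 + ?n else 1 + A / \<bar>?n - A\<bar>)"
  have D: "0 < D" using A by (auto simp: D_def add_pos_nonneg)
  have bound: "ennreal ((1 + R) powr (?n - A)) + ennreal A * (\<integral>\<^sup>+r. ennreal ((1 + r) powr (?n - A - 1)) * indicator {0..R} r \<partial>lborel)
      \<le> ennreal (D * log_corr A ?n R * (1 + R) powr (?n - min A ?n))" if R: "0 \<le> R" for R
  proof (cases "A = ?n")
    case True
    have "1 + ?n * ln (1 + R) \<le> (1 + ?n) * (1 + ln (1 + R))"
      using R by (simp add: algebra_simps)
    then show ?thesis
      using R nn_integral_one_plus_inverse[OF R]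
      by (simp add: True D_def log_corr_def ennreal_leI flip: ennreal_1 ennreal_plus ennreal_mult')
  next
    case False
    let ?x = "(1 + R) powr (?n - A)"
    have I: "(\<integral>\<^sup>+r. ennreal ((1 + r) powr (?n - A - 1)) * indicator {0..R} r \<partial>lborel) = ennreal (?x / (?n - A) - 1 / (?n - A))"
      using nn_integral_one_plus_powr[of 0 R "?n - A"] R False by simp
    \<comment> \<open>The second conjunct is the nonnegativity under which \<open>ennreal\<close>
      commutes with the sum and the product.\<close>
    have "?x + A * (?x / (?n - A) - 1 / (?n - A)) \<le> D * (1 + R) powr (?n - min A ?n) \<and> 0 \<le> ?x / (?n - A) - 1 / (?n - A)"
    proof (cases "A < ?n")
      case True
      then have "1 \<le> ?x" using R by (simp add: ge_one_powr_ge_zero)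
      have 1: "0 \<le> A / (?n - A)" using A True by simp
      have 2: "A * (?x / (?n - A) - 1 / (?n - A)) = A / (?n - A) * ?x - A / (?n - A)"
        by (simp add: right_diff_distrib)
      have 3: "D * (1 + R) powr (?n - min A ?n) = ?x + A / (?n - A) * ?x"
        using True by (simp add: D_def distrib_right)
      have "1 / (?n - A) \<le> ?x / (?n - A)"
        using True \<open>1 \<le> ?x\<close> by (intro divide_right_mono) auto
      then show ?thesis
        unfolding 2 3 using 1 by (intro conjI) (simp_all only: le_diff_eq add_0 add_le_cancel_left diff_le_eq le_add_same_cancel1)
    next
      case F: False
      then have An: "?n < A" using False by simp
      then have x1: "?x \<le> 1" using powr_mono[of "?n - A" 0 "1 + R"] R by simp
      have "x / (?n - A) = - (x / (A - ?n))" for x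
        by (metis minus_diff_eq minus_divide_right)
      then have e: "?x / (?n - A) - 1 / (?n - A) = (1 - ?x) / (A - ?n)"
        by (simp add: diff_divide_distrib)
      have "A * ((1 - ?x) / (A - ?n)) \<le> A * (1 / (A - ?n))"
        using An A x1 by (intro mult_left_mono divide_right_mono) auto
      then show ?thesis
        unfolding e using An x1 R by (simp add: D_def min_def)
    qed
    then show ?thesis
      unfolding I using A False by (simp add: log_corr_def ennreal_leI flip: ennreal_plus ennreal_mult')
  qed
  show ?thesis
  proof (rule that[of "?w * D"])
    fix R :: real assume R: "0 \<le> R"
    have "(\<integral>\<^sup>+y. ennreal ((1 + norm (y::'a)) powr (- A)) * indicator (ball 0 R) y \<partial>lborel)
      \<le> ennreal ?w * ennreal (D * log_corr A ?n R * (1 + R) powr (?n - min A ?n))"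
      by (intro order_trans[OF nn_integral_ball_weight_le[OF A R]] mult_left_mono bound R) simp
    also have "\<dots> = ennreal (?w * D * log_corr A ?n R * (1 + R) powr (?n - min A ?n))"
      using w by (simp add: mult.assoc flip: ennreal_mult')
    finally show "(\<integral>\<^sup>+y. ennreal ((1 + norm (y::'a)) powr (- A)) * indicator (ball 0 R) y \<partial>lborel) \<le> \<dots>" .
  qed (use w D in simp)
qed

context fractional_heat_kernel
begin

lemma heat_scale:
  assumes [measurable]: "f \<in> borel_measurable borel" and "0 \<le> l"
  shows "heat (\<lambda>x. l * f x) x t = ennreal l * heat f x t"
  unfolding heat_def using assms(2)
  by (subst nn_integral_cmult[symmetric]) (auto simp: ennreal_mult' mult.left_commute)

lemma mass_H: "0 < t \<Longrightarrow> (\<integral>\<^sup>+y. H (x - y) t \<partial>lborel) = 1"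
  using mass_G[of t x] by (simp add: H_def)

text \<open>For R > 1, inside the ball of radius R the kernel is at most a multiple of R^(-N) and
  the weight has the mass just estimated; outside, the weight is at most (1 + R)^(-A) and the kernel
  has mass 1. For R \<le> 1 it is enough that f \<le> 1.\<close>

lemma heat_decay_radius:
  fixes A :: real
  assumes A: "0 < A" and f: "f \<in> borel_measurable borel" "\<And>x. f x \<le> (1 + norm x) powr (- A)"
  obtains C where "0 < C" "\<And>x s. 0 < s \<Longrightarrow>
    heat f x s \<le> ennreal (C * log_corr A DIM('a) (s powr (1 / \<theta>)) * (1 + s powr (1 / \<theta>)) powr (- min A DIM('a)))"
proof -
  let ?n = "real DIM('a)" and ?m = "min A (real DIM('a))"
  obtain C0 where C0: "0 < C0" "\<And>R. 0 \<le> R \<Longrightarrow>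
    (\<integral>\<^sup>+y. ennreal ((1 + norm (y::'a)) powr (- A)) * indicator (ball 0 R) y \<partial>lborel)
      \<le> ennreal (C0 * log_corr A ?n R * (1 + R) powr (?n - ?m))"
    using nn_integral_ball_weight_bound[OF A] by blast
  \<comment> \<open>The three summands pay for the interior of the ball, the exterior, and the times
    with R \<le> 1.\<close>
  define C where "C = symbol_mass * 2 powr ?n * C0 + 1 + 2 powr ?m"
  have C: "1 + 2 powr ?m \<le> C" "0 < C"
    using C0(1) symbol_mass_nonneg by (auto simp: C_def add_nonneg_pos)
  have "heat f x s \<le> ennreal (C * log_corr A ?n R * (1 + R) powr (- ?m))"
    if s: "0 < s" and R_def: "R = s powr (1 / \<theta>)" for x s R
  proof -
    have R: "0 < R" using s by (simp add: R_def)
    let ?L = "log_corr A ?n R"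
    have L: "1 \<le> ?L" using R by (intro log_corr_ge_1) simp
    show ?thesis
    proof (cases "R \<le> 1")
      case True
      have "heat f x s \<le> (\<integral>\<^sup>+y. H (x - y) s * 1 \<partial>lborel)"
        unfolding heat_def
      proof (intro nn_integral_mono mult_left_mono)
        fix y :: 'a
        have "f y \<le> 1"
          using f(2)[of y] powr_mono2'[of "- A" 1 "1 + norm y"] A by simp
        then show "ennreal (f y) \<le> 1" using ennreal_leI[of "f y" 1] by simp
      qed simp
      also have "\<dots> = ennreal (1 * 1)" using s by (simp add: mass_H)
      also have "\<dots> \<le> ennreal (?L * (C * (1 + R) powr (- ?m)))"
      proof (intro ennreal_leI mult_mono)
        have "(1 + R) powr ?m \<le> 2 powr ?m"
          using True R A by (intro powr_mono2) auto
        also have "\<dots> \<le> C" using C by simp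
        finally show "1 \<le> C * (1 + R) powr (- ?m)"
          using R by (simp add: powr_minus_divide)
      qed (use L in auto)
      finally show ?thesis by (simp add: mult_ac)
    next
      case False
      \<comment> \<open>Since R > 1, (1 + R) / 2 \<le> R; this is the origin of
        \<open>2 powr ?n\<close>.\<close>
      have decay: "s powr (- ?n / \<theta>) \<le> 2 powr ?n * (1 + R) powr (- ?n)"
      proof -
        have "s powr (- ?n / \<theta>) = R powr (- ?n)"
          using s by (simp add: R_def powr_powr)
        also have "\<dots> \<le> ((1 + R) / 2) powr (- ?n)"
          using False by (intro powr_mono2') auto
        also have "\<dots> = 2 powr ?n * (1 + R) powr (- ?n)"
          using False by (simp add: powr_divide powr_minus_divide)
        finally show ?thesis .
      qed
      let ?M = "symbol_mass * s powr (- ?n / \<theta>)"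
      have M: "0 \<le> ?M" using symbol_mass_nonneg by simp
      have "heat f x s \<le> (\<integral>\<^sup>+y. ennreal ?M * (ennreal ((1 + norm y) powr (- A)) * indicator (ball 0 R) y) +
          ennreal ((1 + R) powr (- A)) * H (x - y) s \<partial>lborel)"
        unfolding heat_def
      proof (intro nn_integral_mono)
        fix y :: 'a
        show "H (x - y) s * ennreal (f y) \<le> ennreal ?M * (ennreal ((1 + norm y) powr (- A)) * indicator (ball 0 R) y) +
          ennreal ((1 + R) powr (- A)) * H (x - y) s"
        proof (cases "norm y < R")
          case True
          have "H (x - y) s * ennreal (f y) \<le> ennreal ?M * ennreal ((1 + norm y) powr (- A))"
            using G_le[OF s, of "x - y"] f(2)[of y] s by (intro mult_mono) (auto simp: H_def ennreal_leI)
          with True show ?thesis by (simp add: add_increasing2)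
        next
          case False
          have "f y \<le> (1 + R) powr (- A)"
            using f(2)[of y] powr_mono2'[of "- A" "1 + R" "1 + norm y"] False R A by simp
          then have "H (x - y) s * ennreal (f y) \<le> ennreal ((1 + R) powr (- A)) * H (x - y) s"
            by (subst mult.commute) (auto intro!: mult_right_mono ennreal_leI)
          with False show ?thesis by simp
        qed
      qed
      also have "\<dots> = ennreal ?M * (\<integral>\<^sup>+y. ennreal ((1 + norm (y::'a)) powr (- A)) * indicator (ball 0 R) y \<partial>lborel) +
          ennreal ((1 + R) powr (- A))"
      proof -
        have m1: "(\<lambda>y::'a. ennreal ((1 + norm y) powr (- A)) * indicator (ball 0 R) y) \<in> borel_measurable lborel"
          by (intro borel_measurable_times_ennreal borel_measurable_indicator) simp_all
        have m2: "(\<lambda>y. H (x - y) s) \<in> borel_measurable lborel"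
          by measurable
        show ?thesis
          by (subst nn_integral_add)
             (simp_all only: nn_integral_cmult[OF m1] nn_integral_cmult[OF m2] mass_H[OF s] mult_1_right
               borel_measurable_times_ennreal borel_measurable_const m1 m2)
      qed
      also have "\<dots> \<le> ennreal ?M * ennreal (C0 * ?L * (1 + R) powr (?n - ?m)) + ennreal ((1 + R) powr (- ?m))"
        using R by (intro add_mono mult_left_mono C0(2) ennreal_leI powr_mono) auto
      also have "\<dots> = ennreal (?M * (C0 * ?L * (1 + R) powr (?n - ?m)) + (1 + R) powr (- ?m))"
        using M C0(1) L by (simp only: ennreal_plus ennreal_mult' mult_nonneg_nonneg powr_ge_zero less_imp_le)
      also have "\<dots> \<le> ennreal (C * ?L * (1 + R) powr (- ?m))"
      proof (rule ennreal_leI)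
        have "?M * (C0 * ?L * (1 + R) powr (?n - ?m)) \<le>
            (symbol_mass * (2 powr ?n * (1 + R) powr (- ?n))) * (C0 * ?L * (1 + R) powr (?n - ?m))"
          using symbol_mass_nonneg C0(1) L by (intro mult_right_mono mult_left_mono decay) auto
        also have "\<dots> = symbol_mass * 2 powr ?n * C0 * ?L * ((1 + R) powr (- ?n) * (1 + R) powr (?n - ?m))"
          by (simp add: mult_ac)
        also have "(1 + R) powr (- ?n) * (1 + R) powr (?n - ?m) = (1 + R) powr (- ?m)"
          by (simp flip: powr_add)
        finally have 1: "?M * (C0 * ?L * (1 + R) powr (?n - ?m)) \<le> symbol_mass * 2 powr ?n * C0 * ?L * (1 + R) powr (- ?m)" .
        have 2: "1 * (1 + R) powr (- ?m) \<le> (1 + 2 powr ?m) * ?L * (1 + R) powr (- ?m)"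
        proof (rule mult_right_mono)
          have "1 * 1 \<le> (1 + 2 powr ?m) * ?L" using L by (intro mult_mono) auto
          then show "1 \<le> (1 + 2 powr ?m) * ?L" by simp
        qed simp
        show "?M * (C0 * ?L * (1 + R) powr (?n - ?m)) + (1 + R) powr (- ?m) \<le> C * ?L * (1 + R) powr (- ?m)"
          using 1 2 by (simp add: C_def distrib_right add.assoc)
      qed
      finally show ?thesis .
    qed
  qed
  then show ?thesis using that C(2) by blast
qed

text \<open>Trades the radius \<open>s powr (1 / \<theta>)\<close> for s itself, so that the time
  integral of the bound has an elementary primitive.\<close>

lemma heat_decay:
  fixes A :: real
  assumes A: "0 < A" and f: "f \<in> borel_measurable borel" "\<And>x. f x \<le> (1 + norm x) powr (- A)"
  obtains C where "0 < C" "\<And>x s. 0 < s \<Longrightarrow>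
    heat f x s \<le> ennreal (C * log_corr A DIM('a) s * (1 + s) powr (- (min A DIM('a) / \<theta>)))"
proof -
  let ?n = "real DIM('a)" and ?m = "min A (real DIM('a))"
  obtain C where C: "0 < C" "\<And>x s. 0 < s \<Longrightarrow>
      heat f x s \<le> ennreal (C * log_corr A ?n (s powr (1 / \<theta>)) * (1 + s powr (1 / \<theta>)) powr (- ?m))"
    using heat_decay_radius[OF A f] by blast
  show ?thesis
  \<comment> \<open>\<open>2 + 1 / \<theta>\<close> absorbs the change of argument in the logarithm;
    \<open>2 powr (?m / \<theta>)\<close> comes from 1 + s \<le> 2 (1 + R)^\<theta> with R =
    s^(1/\<theta>).\<close>
  proof (rule that[of "C * (2 + 1 / \<theta>) * 2 powr (?m / \<theta>)"])
    show "0 < C * (2 + 1 / \<theta>) * 2 powr (?m / \<theta>)"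
      using C \<theta>_pos by (intro mult_pos_pos add_pos_pos) auto
    fix x :: 'a and s :: real assume s: "0 < s"
    let ?R = "s powr (1 / \<theta>)"
    have "ln (1 + ?R) \<le> 1 + ln (1 + s) / \<theta>"
    proof -
      have "1 \<le> (1 + s) powr (1 / \<theta>)"
        using s \<theta>_pos by (intro ge_one_powr_ge_zero) auto
      moreover have "?R \<le> (1 + s) powr (1 / \<theta>)"
        using s \<theta>_pos by (intro powr_mono2) auto
      ultimately have "1 + ?R \<le> 2 * (1 + s) powr (1 / \<theta>)"
        by simp
      then have "ln (1 + ?R) \<le> ln (2 * (1 + s) powr (1 / \<theta>))"
        using s by (subst ln_le_cancel_iff) (auto intro: add_pos_nonneg)
      also have "\<dots> = ln 2 + ln (1 + s) / \<theta>"
        using s by (simp add: ln_mult ln_powr)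
      also have "ln 2 \<le> (1::real)" using ln_2_less_1 by simp
      finally show ?thesis by simp
    qed
    moreover have "1 + (1 + ln (1 + s) / \<theta>) \<le> (2 + 1 / \<theta>) * (1 + ln (1 + s))"
      using s \<theta>_pos by (simp add: algebra_simps)
    moreover have "1 \<le> 2 + 1 / \<theta>" using \<theta>_pos by simp
    ultimately have L: "log_corr A ?n ?R \<le> (2 + 1 / \<theta>) * log_corr A ?n s"
      by (simp add: log_corr_def)
    have P: "(1 + ?R) powr (- ?m) \<le> 2 powr (?m / \<theta>) * (1 + s) powr (- (?m / \<theta>))"
    proof -
      have s_eq: "s = ?R powr \<theta>" using s \<theta>_pos by (simp add: powr_powr)
      have "?R powr \<theta> \<le> (1 + ?R) powr \<theta>"
        using s \<theta>_pos by (intro powr_mono2) auto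
      moreover have "1 \<le> (1 + ?R) powr \<theta>"
        using s \<theta>_pos by (intro ge_one_powr_ge_zero) auto
      ultimately have "1 + s \<le> 2 * (1 + ?R) powr \<theta>"
        using s_eq by simp
      then have "(1 + s) powr (?m / \<theta>) \<le> (2 * (1 + ?R) powr \<theta>) powr (?m / \<theta>)"
        using s \<theta>_pos A by (intro powr_mono2) auto
      also have "\<dots> = 2 powr (?m / \<theta>) * (1 + ?R) powr ?m"
        using \<theta>_pos by (simp add: powr_mult powr_powr)
      finally have le: "(1 + s) powr (?m / \<theta>) \<le> 2 powr (?m / \<theta>) * (1 + ?R) powr ?m" .
      have inv: "1 / Y \<le> c * (1 / X)" if "0 < X" "0 < Y" "X \<le> c * Y" for X Y c :: real
        using that by (simp add: field_simps)
      have "1 / (1 + ?R) powr ?m \<le> 2 powr (?m / \<theta>) * (1 / (1 + s) powr (?m / \<theta>))"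
        using s add_pos_nonneg[OF zero_less_one, of ?R] by (intro inv le) auto
      then show ?thesis by (simp add: powr_minus_divide)
    qed
    have "C * log_corr A ?n ?R * (1 + ?R) powr (- ?m) \<le>
        C * ((2 + 1 / \<theta>) * log_corr A ?n s) * (2 powr (?m / \<theta>) * (1 + s) powr (- (?m / \<theta>)))"
      using C(1) \<theta>_pos log_corr_ge_1[of ?R A ?n] log_corr_ge_1[of s A ?n] s
      by (intro mult_mono L P mult_left_mono mult_nonneg_nonneg) auto
    then show "heat f x s \<le> ennreal (C * (2 + 1 / \<theta>) * 2 powr (?m / \<theta>) * log_corr A ?n s * (1 + s) powr (- (?m / \<theta>)))"
      using order_trans[OF C(2)[OF s, of x] ennreal_leI] by (simp add: mult_ac)
  qed
qed

end

section \<open>From decay to a numerical condition on the time horizon\<close>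

lemma ln_ennreal_ge:
  assumes "ennreal (exp y) \<le> a"
  shows "ereal y \<le> ln_ennreal a"
proof (cases a)
  case (real r)
  have "0 < exp y" by simp
  with assms real have "exp y \<le> r" by simp
  moreover from this have "0 < r" using \<open>0 < exp y\<close> by linarith
  ultimately have "y \<le> ln r" using ln_le_cancel_iff[of "exp y" r] by simp
  with real \<open>0 < r\<close> show ?thesis by (simp add: ln_ennreal_def)
qed (simp add: ln_ennreal_def)

text \<open>The integral of (1 + s)^(-q) over [0, T]. The branch q = 1 is the critical case and the
  origin of the logarithm of the life span.\<close>

definition powr_primitive :: "real \<Rightarrow> real \<Rightarrow> real" where
  "powr_primitive q T = (if q = 1 then ln (1 + T) else ((1 + T) powr (1 - q) - 1) / (1 - q))"

lemma nn_integral_powr_primitive: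
  assumes "0 \<le> T"
  shows "(\<integral>\<^sup>+s. ennreal ((1 + s) powr (- q)) * indicator {0..T} s \<partial>lborel) = ennreal (powr_primitive q T)"
  using nn_integral_one_plus_inverse[OF assms] nn_integral_one_plus_powr[of 0 T "1 - q"] assms
  by (auto simp: powr_primitive_def diff_divide_distrib)

context fractional_heat_kernel
begin

text \<open>Linearity of the heat flow in the datum pulls l out of the decay estimate, so one
  \<kappa> serves all l and T.\<close>

lemma max_existence_time_criterion:
  fixes A p :: real and \<phi> :: "'a \<Rightarrow> real"
  assumes A: "0 < A" and p: "1 < p" and q: "min A DIM('a) * (p - 1) / \<theta> \<le> 1"
    and \<phi>: "\<phi> \<in> borel_measurable lebesgue" "AE x in lebesgue. \<phi> x \<le> (1 + norm x) powr (- A)"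
  obtains \<kappa> where "0 < \<kappa>" "\<And>l T. 0 < l \<Longrightarrow> 0 < T \<Longrightarrow>
    (l * log_corr A DIM('a) T) powr (p - 1) * powr_primitive (min A DIM('a) * (p - 1) / \<theta>) T \<le> \<kappa> \<Longrightarrow>
    ennreal T \<le> max_existence_time p G (function_measure (\<lambda>x. l * \<phi> x))"
proof -
  let ?n = "real DIM('a)" and ?m = "min A (real DIM('a))"
  let ?q = "?m * (p - 1) / \<theta>"
  obtain \<psi>0 where \<psi>0[measurable]: "\<psi>0 \<in> borel_measurable borel" and \<psi>0_eq: "AE x in lborel. \<phi> x = \<psi>0 x"
    using completion_ex_borel_measurable_real[OF \<phi>(1)] by auto
  \<comment> \<open>The decay estimate asks for its bound at every point, whereas \<phi> obeys it
    almost everywhere; the minimum repairs this on a null set.\<close>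
  define \<psi> where "\<psi> x = min (\<psi>0 x) ((1 + norm x) powr (- A))" for x
  have \<psi>[measurable]: "\<psi> \<in> borel_measurable borel" unfolding \<psi>_def by measurable
  have eq: "AE x in lebesgue. \<phi> x = \<psi> x"
    using \<phi>(2) AE_completion[OF \<psi>0_eq] by eventually_elim (simp add: \<psi>_def)
  obtain C where C: "0 < C" "\<And>x s. 0 < s \<Longrightarrow> heat \<psi> x s \<le> ennreal (C * log_corr A ?n s * (1 + s) powr (- (?m / \<theta>)))"
    using heat_decay[OF A \<psi>] by (auto simp: \<psi>_def)
  define K where "K = 2 powr p * C powr (p - 1)"
  have K: "0 < K" using C by (simp add: K_def)
  show ?thesis
  proof (rule that[of "1 / K"])
    show "0 < 1 / K" using K by simp
    fix l T :: real
    assume l: "0 < l" and T: "0 < T"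
      and small: "(l * log_corr A ?n T) powr (p - 1) * powr_primitive ?q T \<le> 1 / K"
    let ?D = "l * C * log_corr A ?n T"
    have L: "1 \<le> log_corr A ?n T" using T by (intro log_corr_ge_1) simp
    have D: "0 < ?D" using l C L by simp
    \<comment> \<open>By monotonicity the logarithmic factor is frozen at the final time T, leaving
      a pure power of 1 + s under the integral.\<close>
    define b where "b s = ?D * (1 + s) powr (- (?m / \<theta>))" for s
    show "ennreal T \<le> max_existence_time p G (function_measure (\<lambda>x. l * \<phi> x))"
    proof (rule max_existence_time_ge[where b = b and f = "\<lambda>x. l * \<psi> x"])
      show "(\<lambda>x. l * \<phi> x) \<in> borel_measurable lebesgue" using \<phi>(1) by simp
      show "AE x in lebesgue. l * \<phi> x = l * \<psi> x" using eq by eventually_elim simp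
      show "0 \<le> b s" for s using D by (simp add: b_def)
      show "b \<in> borel_measurable borel" unfolding b_def by measurable
      show "heat (\<lambda>x. l * \<psi> x) x s \<le> ennreal (b s)" if s: "0 < s" "s < T" for x s
      proof -
        have "heat (\<lambda>x. l * \<psi> x) x s \<le> ennreal l * ennreal (C * log_corr A ?n s * (1 + s) powr (- (?m / \<theta>)))"
          unfolding heat_scale[OF \<psi> less_imp_le[OF l]] by (intro mult_left_mono C s) simp
        also have "\<dots> = ennreal (l * (C * log_corr A ?n s * (1 + s) powr (- (?m / \<theta>))))"
          using l by (simp add: ennreal_mult')
        also have "\<dots> \<le> ennreal (l * (C * log_corr A ?n T * (1 + s) powr (- (?m / \<theta>))))"
          using l C s by (intro ennreal_leI mult_left_mono mult_right_mono log_corr_mono) auto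
        finally show ?thesis by (simp add: b_def mult.assoc)
      qed
      have "(\<integral>\<^sup>+s. ennreal (2 powr p * b s powr (p - 1)) * indicator {0<..<T} s \<partial>lborel) \<le>
          (\<integral>\<^sup>+s. ennreal (2 powr p * ?D powr (p - 1)) * (ennreal ((1 + s) powr (- ?q)) * indicator {0..T} s) \<partial>lborel)"
      proof (intro nn_integral_mono)
        fix s :: real
        show "ennreal (2 powr p * b s powr (p - 1)) * indicator {0<..<T} s \<le>
            ennreal (2 powr p * ?D powr (p - 1)) * (ennreal ((1 + s) powr (- ?q)) * indicator {0..T} s)"
        proof (cases "0 < s \<and> s < T")
          case True
          have "b s powr (p - 1) = ?D powr (p - 1) * (1 + s) powr (- ?q)"
            using D True by (simp add: b_def powr_mult powr_powr)
          with True show ?thesis by (simp add: ennreal_mult' mult.assoc)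
        qed auto
      qed
      also have "\<dots> = ennreal (2 powr p * ?D powr (p - 1)) * ennreal (powr_primitive ?q T)"
        using T by (subst nn_integral_cmult) (simp_all add: nn_integral_powr_primitive)
      also have "\<dots> = ennreal (K * ((l * log_corr A ?n T) powr (p - 1) * powr_primitive ?q T))"
      proof -
        have "?D powr (p - 1) = C powr (p - 1) * (l * log_corr A ?n T) powr (p - 1)"
          using l C L by (simp add: powr_mult mult_ac)
        then show ?thesis
          by (simp add: K_def mult.assoc flip: ennreal_mult')
      qed
      also have "\<dots> \<le> 1"
        using small K by (simp add: field_simps)
      finally show "(\<integral>\<^sup>+s. ennreal (2 powr p * b s powr (p - 1)) * indicator {0<..<T} s \<partial>lborel) \<le> 1" .
    qed (use p T in auto)
  qed
qed

end

section \<open>Lower bounds for the life span\<close>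

lemma ln_one_plus_le:
  fixes T :: real
  assumes "1 \<le> T"
  shows "ln (1 + T) \<le> 1 + ln T"
proof -
  have "ln (1 + T) \<le> ln (2 * T)" using assms by (subst ln_le_cancel_iff) auto
  also have "\<dots> = ln 2 + ln T" using assms by (simp add: ln_mult)
  finally show ?thesis using ln_2_less_1 by linarith
qed

lemma eventually_at_right_0_le_powr:
  fixes a c K :: real
  assumes "0 < a" "0 < c"
  shows "\<forall>\<^sub>F l in at_right 0. K \<le> c * l powr (- a)"
proof -
  have "filterlim (\<lambda>l. c * l powr (- a)) at_top (at_right 0)"
    using assms by real_asymp
  then show ?thesis by (simp add: filterlim_at_top)
qed

context fractional_heat_kernel
begin

context
  fixes A p :: real and \<phi> :: "'a \<Rightarrow> real"
  assumes A: "0 < A" and p: "1 < p"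
    and \<phi>: "\<phi> \<in> borel_measurable lebesgue" "AE x in lebesgue. \<phi> x \<le> (1 + norm x) powr (- A)"
begin

abbreviation "life l \<equiv> max_existence_time p G (function_measure (\<lambda>x. l * \<phi> x))"

text \<open>No logarithmic factor is present, and the condition l^(p-1) ln(1 + T) \<le> \<kappa> is
  tested at T = exp y.\<close>

lemma critical_fast_decay:
  assumes "DIM('a) * (p - 1) = \<theta>" "DIM('a) < A"
  shows "\<exists>C>0. \<forall>\<^sub>F l in at_right 0. ereal (C * l powr (- (p - 1))) \<le> ln_ennreal (life l)"
proof -
  have q: "min A DIM('a) * (p - 1) / \<theta> = 1" using assms \<theta>_pos by simp
  obtain \<kappa> where \<kappa>: "0 < \<kappa>" "\<And>l T. 0 < l \<Longrightarrow> 0 < T \<Longrightarrow>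
      (l * log_corr A DIM('a) T) powr (p - 1) * powr_primitive 1 T \<le> \<kappa> \<Longrightarrow> ennreal T \<le> life l"
    using max_existence_time_criterion[OF A p _ \<phi>] unfolding q by auto
  \<comment> \<open>Half of \<kappa>, because ln(1 + exp y) \<le> 1 + y \<le> 2 y once y \<ge>
    1.\<close>
  define c where "c = \<kappa> / 2"
  have c: "0 < c" using \<kappa> by (simp add: c_def)
  have p1: "0 < p - 1" using p by simp
  have "\<forall>\<^sub>F l in at_right 0. ereal (c * l powr (- (p - 1))) \<le> ln_ennreal (life l)"
    using eventually_at_right_less[of 0] eventually_at_right_0_le_powr[OF p1 c, of 1]
  proof eventually_elim
    case (elim l)
    let ?y = "c * l powr (- (p - 1))"
    have l: "0 < l" using elim by simp
    have y: "1 \<le> ?y" using elim p c by simp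
    have "1 \<le> exp ?y" using y by simp
    from ln_one_plus_le[OF this] have "ln (1 + exp ?y) \<le> 2 * ?y" using y by simp
    then have "l powr (p - 1) * ln (1 + exp ?y) \<le> l powr (p - 1) * (2 * ?y)"
      by (rule mult_left_mono) simp
    also have "\<dots> = \<kappa> * (l powr (p - 1) * l powr (- (p - 1)))" by (simp add: c_def)
    also have "l powr (p - 1) * l powr (- (p - 1)) = 1" using l by (simp flip: powr_add)
    also have "\<kappa> * 1 = \<kappa>" by simp
    finally have "ennreal (exp ?y) \<le> life l"
      using assms l by (intro \<kappa>(2)) (simp_all add: log_corr_def powr_primitive_def)
    then show ?case by (rule ln_ennreal_ge)
  qed
  with c show ?thesis by blast
qed

text \<open>The logarithmic factor contributes p - 1 powers of log T and the time integral one more,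
  so up to constants the condition is l^(p-1) (log T)^p \<le> \<kappa>; hence the exponent (p -
  1)/p.\<close>

lemma critical_borderline_decay:
  assumes "DIM('a) * (p - 1) = \<theta>" "A = DIM('a)"
  shows "\<exists>C>0. \<forall>\<^sub>F l in at_right 0. ereal (C * l powr (- ((p - 1) / p))) \<le> ln_ennreal (life l)"
proof -
  have q: "min A DIM('a) * (p - 1) / \<theta> = 1" using assms \<theta>_pos by simp
  obtain \<kappa> where \<kappa>: "0 < \<kappa>" "\<And>l T. 0 < l \<Longrightarrow> 0 < T \<Longrightarrow>
      (l * log_corr A DIM('a) T) powr (p - 1) * powr_primitive 1 T \<le> \<kappa> \<Longrightarrow> ennreal T \<le> life l"
    using max_existence_time_criterion[OF A p _ \<phi>] unfolding q by auto
  \<comment> \<open>The 3 comes from 1 + ln(1 + exp y) \<le> 2 + y \<le> 3 y for y \<ge> 1, and the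
    root inverts the p-th power of the logarithm.\<close>
  define c where "c = \<kappa> powr (1 / p) / 3"
  have c: "0 < c" using \<kappa> by (simp add: c_def)
  have p1: "0 < (p - 1) / p" using p by simp
  have "\<forall>\<^sub>F l in at_right 0. ereal (c * l powr (- ((p - 1) / p))) \<le> ln_ennreal (life l)"
    using eventually_at_right_less[of 0] eventually_at_right_0_le_powr[OF p1 c, of 1]
  proof eventually_elim
    case (elim l)
    let ?y = "c * l powr (- ((p - 1) / p))"
    have l: "0 < l" using elim by simp
    have y: "1 \<le> ?y" using elim p c by simp
    have T: "1 \<le> exp ?y" using y by simp
    from ln_one_plus_le[OF this] have ln: "1 + ln (1 + exp ?y) \<le> 3 * ?y" using y by simp
    have "0 < ln (1 + exp ?y)" by (rule ln_gt_zero) simp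
    with ln have "(l * (1 + ln (1 + exp ?y))) powr (p - 1) * ln (1 + exp ?y) \<le> (l * (3 * ?y)) powr (p - 1) * (3 * ?y)"
      using l p by (intro mult_mono powr_mono2) auto
    also have "\<dots> = l powr (p - 1) * (3 * ?y) powr p"
      using l y by (simp add: powr_mult powr_diff)
    also have "3 * ?y = \<kappa> powr (1 / p) * l powr (- ((p - 1) / p))"
      by (simp add: c_def)
    also have "l powr (p - 1) * (\<kappa> powr (1 / p) * l powr (- ((p - 1) / p))) powr p = \<kappa>"
    proof -
      have "(\<kappa> powr (1 / p) * l powr (- ((p - 1) / p))) powr p = \<kappa> * l powr (- (p - 1))"
        using \<kappa>(1) p by (simp add: powr_mult powr_powr)
      then have "l powr (p - 1) * (\<kappa> powr (1 / p) * l powr (- ((p - 1) / p))) powr p = \<kappa> * (l powr (p - 1) * l powr (- (p - 1)))"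
        by simp
      also have "l powr (p - 1) * l powr (- (p - 1)) = 1" using l by (simp flip: powr_add)
      finally show ?thesis by simp
    qed
    finally have "ennreal (exp ?y) \<le> life l"
      using assms l by (intro \<kappa>(2)) (simp_all add: log_corr_def powr_primitive_def)
    then show ?case by (rule ln_ennreal_ge)
  qed
  with c show ?thesis by blast
qed

text \<open>Since 1 - q = (p - 1) E, the primitive is at most a multiple of T^((p-1) E), and a
  (p-1)-th root makes the condition linear in l.\<close>

lemma subcritical_criterion:
  assumes E_def: "E = 1 / (p - 1) - min A DIM('a) / \<theta>" and E: "0 < E"
  obtains \<kappa> where "0 < \<kappa>" "\<And>l T. 0 < l \<Longrightarrow> 1 \<le> T \<Longrightarrow>
    l * log_corr A DIM('a) T * T powr E \<le> \<kappa> \<Longrightarrow> ennreal T \<le> life l"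
proof -
  let ?q = "min A DIM('a) * (p - 1) / \<theta>"
  have q: "1 - ?q = (p - 1) * E"
    using p \<theta>_pos by (simp add: E_def right_diff_distrib mult.commute)
  have pE: "0 < (p - 1) * E" using p E by simp
  then have "?q \<le> 1" using q by linarith
  then obtain \<kappa>0 where \<kappa>0: "0 < \<kappa>0" "\<And>l T. 0 < l \<Longrightarrow> 0 < T \<Longrightarrow>
      (l * log_corr A DIM('a) T) powr (p - 1) * powr_primitive ?q T \<le> \<kappa>0 \<Longrightarrow> ennreal T \<le> life l"
    using max_existence_time_criterion[OF A p _ \<phi>] by blast
  \<comment> \<open>\<open>2 powr E\<close> compensates for 1 + T \<le> 2 T, and
    \<open>(p - 1) * E\<close> for the denominator of the primitive.\<close>
  define \<kappa> where "\<kappa> = (\<kappa>0 * ((p - 1) * E)) powr (1 / (p - 1)) / 2 powr E"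
  have \<kappa>: "0 < \<kappa>" using \<kappa>0 p E by (simp add: \<kappa>_def)
  show ?thesis
  proof (rule that[OF \<kappa>])
    fix l T :: real
    assume l: "0 < l" and T: "1 \<le> T" and small: "l * log_corr A DIM('a) T * T powr E \<le> \<kappa>"
    let ?L = "log_corr A DIM('a) T"
    have L: "1 \<le> ?L" using T by (intro log_corr_ge_1) simp
    have "powr_primitive ?q T = ((1 + T) powr ((p - 1) * E) - 1) / ((p - 1) * E)"
      using pE q by (auto simp: powr_primitive_def)
    also have "\<dots> \<le> (2 * T) powr ((p - 1) * E) / ((p - 1) * E)"
    proof (intro divide_right_mono)
      have "(1 + T) powr ((p - 1) * E) \<le> (2 * T) powr ((p - 1) * E)"
        using T pE by (intro powr_mono2) auto
      then show "(1 + T) powr ((p - 1) * E) - 1 \<le> (2 * T) powr ((p - 1) * E)" by simp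
    qed (use pE in simp)
    finally have "(l * ?L) powr (p - 1) * powr_primitive ?q T \<le>
        (l * ?L) powr (p - 1) * ((2 * T) powr ((p - 1) * E) / ((p - 1) * E))"
      by (rule mult_left_mono) simp
    also have "\<dots> = (l * ?L * T powr E * 2 powr E) powr (p - 1) / ((p - 1) * E)"
      using l L T by (simp add: powr_mult powr_powr mult_ac)
    also have "\<dots> \<le> (\<kappa> * 2 powr E) powr (p - 1) / ((p - 1) * E)"
      using small l L p pE by (intro divide_right_mono powr_mono2 mult_right_mono) auto
    also have "\<dots> = \<kappa>0"
    proof -
      have "(\<kappa> * 2 powr E) powr (p - 1) = \<kappa>0 * ((p - 1) * E)"
        using \<kappa>0(1) pE p by (simp add: \<kappa>_def powr_powr)
      then show ?thesis using E p by simp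
    qed
    finally show "ennreal T \<le> life l" using l T by (intro \<kappa>0(2)) auto
  qed
qed

text \<open>The condition l T^E \<le> \<kappa> is an equality at T = (\<kappa> / l)^(1/E), and small
  l ensures T \<ge> 1.\<close>

lemma subcritical_generic_decay:
  assumes E_def: "E = 1 / (p - 1) - min A DIM('a) / \<theta>" and E: "0 < E" and "A \<noteq> DIM('a)"
  shows "\<exists>C>0. \<forall>\<^sub>F l in at_right 0. ennreal (C * l powr (- inverse E)) \<le> life l"
proof -
  obtain \<kappa> where \<kappa>: "0 < \<kappa>" "\<And>l T. 0 < l \<Longrightarrow> 1 \<le> T \<Longrightarrow>
      l * log_corr A DIM('a) T * T powr E \<le> \<kappa> \<Longrightarrow> ennreal T \<le> life l"
    using subcritical_criterion[OF E_def E] by blast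
  define c where "c = \<kappa> powr (1 / E)"
  have c: "0 < c" using \<kappa> by (simp add: c_def)
  have E1: "0 < inverse E" using E by simp
  have "\<forall>\<^sub>F l in at_right 0. ennreal (c * l powr (- inverse E)) \<le> life l"
    using eventually_at_right_less[of 0] eventually_at_right_0_le_powr[OF E1 c, of 1]
  proof eventually_elim
    case (elim l)
    have "(c * l powr (- inverse E)) powr E = \<kappa> * l powr (-1)"
      using \<kappa>(1) E by (simp add: c_def powr_mult powr_powr)
    moreover have "l * (\<kappa> * inverse l) \<le> \<kappa>" using elim by (simp add: field_simps)
    ultimately show ?case
      using elim E c assms(3) by (intro \<kappa>(2)) (auto simp: log_corr_def powr_minus)
  qed
  with c show ?thesis by blast
qed

text \<open>For T a power of 1/l up to logarithms, log T is comparable to log(1/l); so l T^E log T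
  stays bounded when T^E is of order (1/l) / log(1/l).\<close>

lemma subcritical_borderline_decay:
  assumes E_def: "E = 1 / (p - 1) - DIM('a) / \<theta>" and E: "0 < E" and AN: "A = DIM('a)"
  shows "\<exists>C>0. \<forall>\<^sub>F l in at_right 0. ennreal (C * (inverse l / ln (inverse l)) powr (inverse E)) \<le> life l"
proof -
  obtain \<kappa> where \<kappa>: "0 < \<kappa>" "\<And>l T. 0 < l \<Longrightarrow> 1 \<le> T \<Longrightarrow>
      l * log_corr A DIM('a) T * T powr E \<le> \<kappa> \<Longrightarrow> ennreal T \<le> life l"
    using subcritical_criterion[of E] E_def E AN by auto
  \<comment> \<open>\<open>2 + 1 / E\<close> is the constant with which the logarithmic factor at T
    will be bounded by \<open>ln (inverse l)\<close>.\<close>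
  define k where "k = \<kappa> / (2 + 1 / E)"
  \<comment> \<open>The cap 1 gives T \<le> l^(-1/E), hence an upper bound on log T; the other entry
    gives c^E \<le> k.\<close>
  define c where "c = min 1 (k powr (1 / E))"
  have k: "0 < k" using \<kappa> E by (simp add: k_def add_pos_pos)
  have c: "0 < c" "c \<le> 1" using k by (auto simp: c_def)
  have cE: "c powr E \<le> k"
  proof -
    have "c powr E \<le> (k powr (1 / E)) powr E"
      using c E by (intro powr_mono2) (auto simp: c_def)
    then show ?thesis using k E by (simp add: powr_powr)
  qed
  have "filterlim (\<lambda>l. c * (inverse l / ln (inverse l)) powr (inverse E)) at_top (at_right 0)"
    using c E by real_asymp
  then have ev1: "\<forall>\<^sub>F l in at_right 0. 1 \<le> c * (inverse l / ln (inverse l)) powr (inverse E)"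
    by (simp add: filterlim_at_top)
  have "filterlim (\<lambda>l::real. ln (inverse l)) at_top (at_right 0)" by real_asymp
  then have ev2: "\<forall>\<^sub>F l::real in at_right 0. 1 \<le> ln (inverse l)"
    by (simp only: filterlim_at_top)
  have "\<forall>\<^sub>F l in at_right 0. ennreal (c * (inverse l / ln (inverse l)) powr (inverse E)) \<le> life l"
    using eventually_at_right_less[of 0] ev1 ev2
  proof eventually_elim
    case (elim l)
    let ?\<Lambda> = "ln (inverse l)"
    let ?z = "inverse l / ?\<Lambda>"
    let ?T = "c * ?z powr (inverse E)"
    have l: "0 < l" and T: "1 \<le> ?T" and \<Lambda>: "1 \<le> ?\<Lambda>" using elim by auto
    have \<Lambda>0: "0 < ?\<Lambda>" using \<Lambda> by linarith
    have z: "0 < ?z" "?z \<le> inverse l"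
      using l \<Lambda>0 divide_left_mono[OF \<Lambda>, of "inverse l"] by (simp_all del: ln_inverse)
    have "?T \<le> 1 * inverse l powr (inverse E)"
      using c z E by (intro mult_mono powr_mono2) auto
    then have "ln ?T \<le> ln (inverse l powr (inverse E))"
      using T by (subst ln_le_cancel_iff) auto
    also have "\<dots> = inverse E * ?\<Lambda>"
      using l by (simp only: ln_powr)
    finally have "1 + ln (1 + ?T) \<le> 2 + inverse E * ?\<Lambda>"
      using ln_one_plus_le[OF T] by linarith
    also have "\<dots> \<le> (2 + 1 / E) * ?\<Lambda>"
      using \<Lambda> by (simp add: distrib_right inverse_eq_divide)
    finally have L: "log_corr A DIM('a) ?T \<le> (2 + 1 / E) * ?\<Lambda>"
      using AN by (simp add: log_corr_def)
    have "(c * z powr (inverse E)) powr E = c powr E * z" if "0 < z" for z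
      using c E that by (simp add: powr_mult powr_powr)
    from this[OF z(1)] have TE: "?T powr E \<le> k * ?z"
      using cE z by (metis less_imp_le mult_right_mono)
    have "l * log_corr A DIM('a) ?T * ?T powr E \<le> l * ((2 + 1 / E) * ?\<Lambda>) * (k * ?z)"
    proof (rule mult_mono[OF mult_left_mono[OF L] TE])
      have "0 \<le> (2 + 1 / E) * ?\<Lambda>" using E \<Lambda>0 by (intro mult_nonneg_nonneg add_nonneg_nonneg) auto
      then show "0 \<le> l * ((2 + 1 / E) * ?\<Lambda>)" by (rule mult_nonneg_nonneg[OF less_imp_le[OF l]])
    qed (use l in auto)
    \<comment> \<open>The logarithm bounding \<open>log_corr\<close> cancels the one in the
      denominator of \<open>?z\<close>.\<close>
    also have "\<dots> = ((2 + 1 / E) * k) * ((l * inverse l) * (?\<Lambda> / ?\<Lambda>))"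
      by (simp only: divide_inverse mult_ac)
    also have "\<dots> = \<kappa>"
    proof -
      have "2 + 1 / E \<noteq> 0" using E by (simp add: add_pos_pos less_imp_neq[symmetric])
      moreover have "?\<Lambda> \<noteq> 0" using \<Lambda> by linarith
      ultimately show ?thesis using l by (simp add: k_def del: ln_inverse)
    qed
    finally show ?case using l T by (intro \<kappa>(2))
  qed
  with c show ?thesis by blast
qed

end
end

theorem theorem5p1:
  fixes \<theta> p p\<theta> A :: real
    and \<phi> :: "'a::euclidean_space \<Rightarrow> real"
    and G :: "'a \<Rightarrow> real \<Rightarrow> real"
    and T :: "real \<Rightarrow> ennreal"
  assumes "0 < \<theta>" "\<theta> \<le> 2" "1 < p"
    and p\<theta>_def: "p\<theta> = 1 + \<theta> / DIM('a)"
    and G: "fundamental_solution \<theta> G"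
    and "0 < A"
    and "\<phi> \<in> borel_measurable lebesgue" "\<And>x. 0 \<le> \<phi> x"
    and "AE x in lebesgue. \<phi> x \<le> (1 + norm x) powr (- A)"
    and T_def: "\<And>l. T l = max_existence_time p G (function_measure (\<lambda>x. l * \<phi> x))"
  shows "(p = p\<theta> \<and> \<theta> / (p - 1) \<le> A \<longrightarrow>
      (\<exists>C1>0. \<forall>\<^sub>F l in at_right 0.
        ln_ennreal (T l) \<ge>
          (if A > DIM('a) then ereal (C1 * l powr (- (p - 1)))
           else ereal (C1 * l powr (- ((p - 1) / p))))))
    \<and> (p < p\<theta> \<or> A < \<theta> / (p - 1) \<longrightarrow>
      (\<exists>C2>0. \<forall>\<^sub>F l in at_right 0.
        T l \<ge>
          (if A \<noteq> DIM('a)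
           then ennreal (C2 * l powr (- inverse (1 / (p - 1) - 1 / \<theta> * min A DIM('a))))
           else ennreal (C2 * (inverse l / ln (inverse l)) powr (inverse (1 / (p - 1) - DIM('a) / \<theta>))))))"
proof -
  interpret fractional_heat_kernel \<theta> G
    using assms(1) G by unfold_locales
  note hyps = \<open>0 < A\<close> \<open>1 < p\<close> assms(7,9)
  show ?thesis
  proof (intro conjI impI)
    assume *: "p = p\<theta> \<and> \<theta> / (p - 1) \<le> A"
    then have n: "DIM('a) * (p - 1) = \<theta>" by (simp add: p\<theta>_def)
    \<comment> \<open>At the critical exponent the threshold \<theta>/(p - 1) is the dimension, so
      under the hypothesis on A the else branch means A = N.\<close>
    then have "\<theta> / (p - 1) = DIM('a)" using \<open>1 < p\<close> by (simp add: field_simps)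
    with * have "DIM('a) \<le> A" by simp
    then show "\<exists>C1>0. \<forall>\<^sub>F l in at_right 0. ln_ennreal (T l) \<ge>
          (if A > DIM('a) then ereal (C1 * l powr (- (p - 1)))
           else ereal (C1 * l powr (- ((p - 1) / p))))"
      unfolding T_def using critical_fast_decay[OF hyps n] critical_borderline_decay[OF hyps n]
      by (cases "A = DIM('a)") auto
  next
    assume *: "p < p\<theta> \<or> A < \<theta> / (p - 1)"
    let ?E = "1 / (p - 1) - min A DIM('a) / \<theta>"
    have E: "0 < ?E"
    proof -
      \<comment> \<open>The first alternative puts N below \<theta>/(p - 1), the second puts A below
        it; either way E is positive.\<close>
      have "min A DIM('a) < \<theta> / (p - 1)"
        using *
      proof
        assume "p < p\<theta>"
        then have "p - 1 < \<theta> / DIM('a)" by (simp add: p\<theta>_def)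
        then have "DIM('a) < \<theta> / (p - 1)" using \<open>1 < p\<close> by (simp add: field_simps)
        then show ?thesis by simp
      qed simp
      then show ?thesis using \<open>0 < \<theta>\<close> \<open>1 < p\<close> by (simp add: field_simps)
    qed
    have eq: "1 / \<theta> * min A DIM('a) = min A DIM('a) / \<theta>" by simp
    show "\<exists>C2>0. \<forall>\<^sub>F l in at_right 0. T l \<ge>
          (if A \<noteq> DIM('a)
           then ennreal (C2 * l powr (- inverse (1 / (p - 1) - 1 / \<theta> * min A DIM('a))))
           else ennreal (C2 * (inverse l / ln (inverse l)) powr (inverse (1 / (p - 1) - DIM('a) / \<theta>))))"
    proof (cases "A = DIM('a)")
      case True
      with subcritical_borderline_decay[OF hyps refl _ True] E show ?thesis
        unfolding T_def by simp
    next
      case False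
      with subcritical_generic_decay[OF hyps refl E False] show ?thesis
        unfolding T_def eq by simp
    qed
  qed
qed

end
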